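(* Let $k$ be a positive integer. For every affine permutation $w\in\widetilde{S}_{k+1}$, the affine Stanley symmetric polynomial $\widetilde{F}_w$ (in finitely many variables $x_1,\ldots,x_n$) is M-convex.
   Context: $\widetilde{S}_{k+1}$ is the affine symmetric group generated by $s_0,\ldots,s_k$ with relations $s_i^2=\mathrm{id}$, $s_is_{i+1}s_i=s_{i+1}s_is_{i+1}$, and $s_is_j=s_js_i$ when $|i-j|\ne1\bmod(k+1)$ (indices mod $k+1$). The length $\ell(w)$ is the length of a reduced (shortest) word for $w$. An element $w$ is cyclically decreasing if it has a reduced word $s_{i_1}\cdots s_{i_l}$ in which all generators are distinct and, whenever both $s_i$ and $s_{i+1}$ occur, $s_{i+1}$ precedes $s_i$. A cyclically decreasing decomposition of $w$ is a factorization $w=w^1w^2\cdots w^r$ with each $w^i$ cyclically decreasing and $\ell(w)=\sum_i\ell(w^i)$. The affine Stanley symmetric function is $\widetilde{F}_w=\sum x_1^{\ell(w^1)}x_2^{\ell(w^2)}\cdots x_r^{\ell(w^r)}$ over all cyclically decreasing decompositions of $w$; the polynomial is obtained by setting $x_i=0$ for $i>n$. A polynomial is M-convex if its support $J=\{\alpha\in\mathbb{N}^n:\text{coefficient of }x^\alpha\ne0\}$ satisfies: for all $\alpha,\beta\in J$ and every $i$ with $\alpha_i>\beta_i$ there is $j$ with $\alpha_j<\beta_j$ and $\alpha-e_i+e_j\in J$. *)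

theory Defs
  imports "HOL-Algebra.Group" "HOL-Library.Poly_Mapping"
begin

section \<open>The affine symmetric group\<close>

text \<open>
  The word \<open>[i\<^sub>1, \<dots>, i\<^sub>l]\<close> with letters in \<open>{0..k}\<close> stands for the product of the generators
  with these indices. Two words are equivalent iff the Coxeter relations identify them; since
  the generators are involutions, no formal inverses are needed to present the group.
\<close>

definition next_idx :: "nat \<Rightarrow> nat \<Rightarrow> nat" where
  "next_idx k i = Suc i mod Suc k"

text \<open>
  Generators with adjacent indices (difference 1 or -1 modulo \<open>k + 1\<close>) satisfy the braid
  relation, all others commute. For \<open>k = 1\<close> the two indices are adjacent on both sides and, as
  usual in affine type A, there is no braid relation: the group is the infinite dihedral group.
\<close>

inductive word_eq :: "nat \<Rightarrow> nat list \<Rightarrow> nat list \<Rightarrow> bool" for k :: nat where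
  refl: "set u \<subseteq> {0..k} \<Longrightarrow> word_eq k u u"
| sym: "word_eq k u v \<Longrightarrow> word_eq k v u"
| trans: "word_eq k u v \<Longrightarrow> word_eq k v w \<Longrightarrow> word_eq k u w"
| append: "word_eq k u u' \<Longrightarrow> word_eq k v v' \<Longrightarrow> word_eq k (u @ v) (u' @ v')"
| square: "i \<le> k \<Longrightarrow> word_eq k [i, i] []"
| braid: "2 \<le> k \<Longrightarrow> i \<le> k \<Longrightarrow> j = next_idx k i \<Longrightarrow> word_eq k [i, j, i] [j, i, j]"
| comm: "i \<le> k \<Longrightarrow> j \<le> k \<Longrightarrow> j \<noteq> next_idx k i \<Longrightarrow> i \<noteq> next_idx k j \<Longrightarrow>
    word_eq k [i, j] [j, i]"

definition word_rel :: "nat \<Rightarrow> (nat list \<times> nat list) set" where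
  "word_rel k = {(u, v). word_eq k u v}"

definition affine_sym :: "nat \<Rightarrow> nat list set monoid" where
  "affine_sym k =
    \<lparr>carrier = lists {0..k} // word_rel k,
     mult = (\<lambda>X Y. \<Union>x\<in>X. \<Union>y\<in>Y. word_rel k `` {x @ y}),
     one = word_rel k `` {[]}\<rparr>"

lemma word_eq_lists:
  assumes "word_eq k u v"
  shows "u \<in> lists {0..k} \<and> v \<in> lists {0..k}"
proof -
  have "next_idx k i \<le> k" for i
    unfolding next_idx_def by (metis lessI less_Suc_eq_le mod_less_divisor zero_less_Suc)
  with assms show ?thesis
    by (induction rule: word_eq.induct) (auto simp: in_lists_conv_set)
qed

lemma equiv_word_rel: "equiv (lists {0..k}) (word_rel k)"
proof (rule equivI)
  show "word_rel k \<subseteq> lists {0..k} \<times> lists {0..k}"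
    using word_eq_lists unfolding word_rel_def by blast
  show "refl_on (lists {0..k}) (word_rel k)"
    by (auto simp: refl_on_def word_rel_def in_lists_conv_set intro!: word_eq.refl)
  show "Relation.sym (word_rel k)"
    by (rule symI) (simp add: word_rel_def word_eq.sym)
  show "Relation.trans (word_rel k)"
    by (rule transI) (simp add: word_rel_def, rule word_eq.trans)
qed

lemma affine_sym_mult_class:
  assumes "u \<in> lists {0..k}" and "v \<in> lists {0..k}"
  shows "(word_rel k `` {u}) \<otimes>\<^bsub>affine_sym k\<^esub> (word_rel k `` {v}) = word_rel k `` {u @ v}"
proof -
  have "congruent2 (word_rel k) (word_rel k) (\<lambda>x y. word_rel k `` {x @ y})"
  proof (rule congruent2I')
    fix a a' b b' assume "(a, a') \<in> word_rel k" "(b, b') \<in> word_rel k"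
    then have "(a @ b, a' @ b') \<in> word_rel k"
      by (simp add: word_rel_def word_eq.append)
    then show "word_rel k `` {a @ b} = word_rel k `` {a' @ b'}"
      by (rule equiv_class_eq[OF equiv_word_rel])
  qed
  then show ?thesis
    unfolding affine_sym_def
    using UN_equiv_class2[OF equiv_word_rel equiv_word_rel _ assms] by simp
qed

lemma group_affine_sym: "group (affine_sym k)"
proof (rule groupI)
  have cls: "\<exists>u. u \<in> lists {0..k} \<and> x = word_rel k `` {u}"
    if "x \<in> carrier (affine_sym k)" for x
    using that by (auto simp: affine_sym_def elim!: quotientE)
  have cls': "word_rel k `` {u} \<in> carrier (affine_sym k)" if "u \<in> lists {0..k}" for u
    using that by (auto simp: affine_sym_def intro!: quotientI)
  have one: "\<one>\<^bsub>affine_sym k\<^esub> = word_rel k `` {[]}"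
    by (simp add: affine_sym_def)
  show "x \<otimes>\<^bsub>affine_sym k\<^esub> y \<in> carrier (affine_sym k)"
    if xy: "x \<in> carrier (affine_sym k)" "y \<in> carrier (affine_sym k)" for x y
  proof -
    obtain a b where "a \<in> lists {0..k}" "b \<in> lists {0..k}"
      "x = word_rel k `` {a}" "y = word_rel k `` {b}"
      using cls[OF xy(1)] cls[OF xy(2)] by blast
    then show ?thesis
      by (simp add: affine_sym_mult_class cls')
  qed
  show "\<one>\<^bsub>affine_sym k\<^esub> \<in> carrier (affine_sym k)"
    by (simp add: one cls')
  show "x \<otimes>\<^bsub>affine_sym k\<^esub> y \<otimes>\<^bsub>affine_sym k\<^esub> z = x \<otimes>\<^bsub>affine_sym k\<^esub> (y \<otimes>\<^bsub>affine_sym k\<^esub> z)"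
    if xyz: "x \<in> carrier (affine_sym k)" "y \<in> carrier (affine_sym k)" "z \<in> carrier (affine_sym k)"
    for x y z
  proof -
    obtain a b c where "a \<in> lists {0..k}" "b \<in> lists {0..k}" "c \<in> lists {0..k}"
      "x = word_rel k `` {a}" "y = word_rel k `` {b}" "z = word_rel k `` {c}"
      using cls[OF xyz(1)] cls[OF xyz(2)] cls[OF xyz(3)] by blast
    then show ?thesis
      by (simp add: affine_sym_mult_class)
  qed
  show "\<one>\<^bsub>affine_sym k\<^esub> \<otimes>\<^bsub>affine_sym k\<^esub> x = x" if "x \<in> carrier (affine_sym k)" for x
    using cls[OF that] affine_sym_mult_class[of "[]"] by (auto simp: one)
  show "\<exists>y\<in>carrier (affine_sym k). y \<otimes>\<^bsub>affine_sym k\<^esub> x = \<one>\<^bsub>affine_sym k\<^esub>"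
    if x: "x \<in> carrier (affine_sym k)" for x
  proof -
    obtain u where u: "u \<in> lists {0..k}" "x = word_rel k `` {u}"
      using cls[OF x] by blast
    have "word_eq k (rev v @ v) []" if "v \<in> lists {0..k}" for v
      using that
    proof (induction v)
      case Nil
      show ?case by (simp add: word_eq.refl)
    next
      case (Cons i v)
      then have "word_eq k [i, i] []" "word_eq k (rev v) (rev v)" "word_eq k v v"
        by (auto simp: in_lists_conv_set intro!: word_eq.intros(1,5))
      from word_eq.append[OF this(2) word_eq.append[OF this(1,3)]]
      have "word_eq k (rev (i # v) @ i # v) (rev v @ v)"
        by simp
      moreover have "word_eq k (rev v @ v) []"
        using Cons by simp
      ultimately show ?case
        by (rule word_eq.trans)
    qed
    with u(1) have "word_rel k `` {rev u @ u} = word_rel k `` {[]}"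
      by (intro equiv_class_eq[OF equiv_word_rel]) (simp add: word_rel_def)
    moreover have "rev u \<in> lists {0..k}"
      using u(1) by (auto simp: in_lists_conv_set)
    ultimately show ?thesis
      using u by (intro bexI[of _ "word_rel k `` {rev u}"])
        (simp_all add: affine_sym_mult_class one cls')
  qed
qed

section \<open>Cyclically decreasing decompositions\<close>

text \<open>An element is an equivalence class, so its members are all the words representing it.\<close>

definition len :: "nat list set \<Rightarrow> nat" where
  "len w = (LEAST l. \<exists>u\<in>w. length u = l)"

definition reduced_word :: "nat list set \<Rightarrow> nat list \<Rightarrow> bool" where
  "reduced_word w u \<longleftrightarrow> u \<in> w \<and> length u = len w"

definition cyclically_decreasing :: "nat \<Rightarrow> nat list set \<Rightarrow> bool" where
  "cyclically_decreasing k w \<longleftrightarrow> w \<in> carrier (affine_sym k) \<and>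
    (\<exists>u. reduced_word w u \<and> distinct u \<and>
      (\<forall>p<length u. \<forall>q<length u. u ! p = next_idx k (u ! q) \<longrightarrow> p < q))"

definition cyc_dec_decomp :: "nat \<Rightarrow> nat list set \<Rightarrow> nat list set list \<Rightarrow> bool" where
  "cyc_dec_decomp k w ws \<longleftrightarrow>
    (\<forall>v\<in>set ws. cyclically_decreasing k v) \<and>
    w = foldr (\<otimes>\<^bsub>affine_sym k\<^esub>) ws \<one>\<^bsub>affine_sym k\<^esub> \<and>
    len w = (\<Sum>v\<leftarrow>ws. len v)"

section \<open>The affine Stanley symmetric polynomial\<close>

text \<open>
  Monomials in the variables \<open>x\<^sub>1, x\<^sub>2, \<dots>\<close> are exponent vectors of type \<open>nat \<Rightarrow>\<^sub>0 nat\<close>, and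
  polynomials over the integers have type \<open>(nat \<Rightarrow>\<^sub>0 nat) \<Rightarrow>\<^sub>0 int\<close>.
\<close>

definition var :: "nat \<Rightarrow> (nat \<Rightarrow>\<^sub>0 nat) \<Rightarrow>\<^sub>0 int" where
  "var i = Poly_Mapping.single (Poly_Mapping.single i 1) 1"

text \<open>
  The affine Stanley symmetric function sums over decompositions into an unbounded number of
  factors, where appending trivial factors is not regarded as changing the decomposition. Setting
  \<open>x\<^sub>i = 0\<close> for \<open>i > n\<close> keeps those whose factors after the \<open>n\<close>-th are trivial, that is,
  the decompositions into exactly \<open>n\<close> factors, trivial ones being allowed.
\<close>

definition affine_stanley :: "nat \<Rightarrow> nat \<Rightarrow> nat list set \<Rightarrow> (nat \<Rightarrow>\<^sub>0 nat) \<Rightarrow>\<^sub>0 int" where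
  "affine_stanley k n w =
    (\<Sum>ws | length ws = n \<and> cyc_dec_decomp k w ws. \<Prod>i\<in>{1..n}. var i ^ len (ws ! (i - 1)))"

text \<open>The sum is genuinely finite, so it does not collapse to the default value 0.\<close>

lemma finite_cyclically_decreasing: "finite {v. cyclically_decreasing k v}"
proof -
  have "length u \<le> Suc k" if "set u \<subseteq> {0..k}" "distinct u" for u
    using card_mono[OF _ that(1)] distinct_card[OF that(2)] by simp
  then have "{u. u \<in> lists {0..k} \<and> distinct u} \<subseteq> {u. set u \<subseteq> {0..k} \<and> length u \<le> Suc k}"
    by (auto simp: in_lists_conv_set subset_iff)
  then have "finite {u. u \<in> lists {0..k} \<and> distinct u}"
    using finite_lists_length_le[of "{0..k}" "Suc k"] finite_subset by blast
  moreover have "{v. cyclically_decreasing k v} \<subseteq>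
    (\<lambda>u. word_rel k `` {u}) ` {u. u \<in> lists {0..k} \<and> distinct u}"
  proof
    fix v assume "v \<in> {v. cyclically_decreasing k v}"
    then obtain u where u: "v \<in> lists {0..k} // word_rel k" "u \<in> v" "distinct u"
      by (auto simp: cyclically_decreasing_def reduced_word_def affine_sym_def)
    then obtain x where x: "x \<in> lists {0..k}" "v = word_rel k `` {x}"
      by (elim quotientE)
    with u(2) have "(x, u) \<in> word_rel k"
      by simp
    then have "v = word_rel k `` {u}" "u \<in> lists {0..k}"
      using x(2) equiv_class_eq[OF equiv_word_rel] word_eq_lists[of k x u]
      by (simp_all add: word_rel_def)
    with u(3) show "v \<in> (\<lambda>u. word_rel k `` {u}) ` {u. u \<in> lists {0..k} \<and> distinct u}"
      by blast
  qed
  ultimately show ?thesis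
    using finite_surj by blast
qed

lemma finite_cyc_dec_decomps: "finite {ws. length ws = n \<and> cyc_dec_decomp k w ws}"
  by (rule finite_subset[OF _ finite_lists_length_eq[OF finite_cyclically_decreasing, of k n]])
    (auto simp: cyc_dec_decomp_def)

section \<open>M-convexity\<close>

definition poly_support :: "nat \<Rightarrow> ((nat \<Rightarrow>\<^sub>0 nat) \<Rightarrow>\<^sub>0 int) \<Rightarrow> (nat \<Rightarrow>\<^sub>0 nat) set" where
  "poly_support n p =
    {\<alpha>. Poly_Mapping.keys \<alpha> \<subseteq> {1..n} \<and> Poly_Mapping.lookup p \<alpha> \<noteq> 0}"

text \<open>The truncated subtraction below is harmless, as the \<open>i\<close>-th entry of \<open>\<alpha>\<close> is positive.\<close>

definition M_convex :: "nat \<Rightarrow> ((nat \<Rightarrow>\<^sub>0 nat) \<Rightarrow>\<^sub>0 int) \<Rightarrow> bool" where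
  "M_convex n p \<longleftrightarrow>
    (\<forall>\<alpha>\<in>poly_support n p. \<forall>\<beta>\<in>poly_support n p. \<forall>i\<in>{1..n}.
      Poly_Mapping.lookup \<alpha> i > Poly_Mapping.lookup \<beta> i \<longrightarrow>
      (\<exists>j\<in>{1..n}. Poly_Mapping.lookup \<alpha> j < Poly_Mapping.lookup \<beta> j \<and>
        \<alpha> - Poly_Mapping.single i 1 + Poly_Mapping.single j 1 \<in> poly_support n p))"

end

theory Submission
  imports Defs
begin

text \<open>
  The inverse of an affine permutation has a code in \<open>\<nat>\<^sup>k\<^sup>+\<^sup>1\<close>, whose sum is its length. Multiplying on the left by
  a cyclically decreasing element with letter set \<open>S\<close>, lengths being additive, permutes the entries of
  the code and then increases those at the positions in \<open>S\<close> by one. So the exponents of a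
  decomposition are the row sums of a 0/1-matrix whose column sums are the code. Conversely every
  such row sum vector occurs: as in the proof of the Gale-Ryser theorem, the first row can be moved
  to the positions of the largest entries of the code, and with ties broken suitably a cyclically
  decreasing factor with these letters splits off. Hence the support is that of a product of
  elementary symmetric polynomials, a Minkowski sum of hypersimplices, and M-convexity follows by
  moving entries in a 0/1-matrix.
\<close>

section \<open>Codes of words\<close>

text \<open>If \<open>c x\<close> counts the \<open>t > x\<close> with \<open>w\<^sup>-\<^sup>1(t) < w\<^sup>-\<^sup>1(x)\<close>, for an affine permutation \<open>w\<close> of the integers, then
  multiplying \<open>w\<close> on the left by the transposition of \<open>x\<close> and \<open>y = x + 1\<close> changes \<open>c\<close> in this way, and
  the length goes down iff \<open>c y < c x\<close>. Below, only the action on codes is used.\<close>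

definition code_swap :: "'a \<Rightarrow> 'a \<Rightarrow> ('a \<Rightarrow> nat) \<Rightarrow> 'a \<Rightarrow> nat" where
  "code_swap x y c = (if c y < c x then c(x := c y, y := c x - 1) else c(x := Suc (c y), y := c x))"

text \<open>The two branches undo each other: the descent branch leaves an entry at \<open>x\<close>
  that is at most the one at \<open>y\<close>, the other branch leaves a larger one, so the second
  application takes the opposite branch.\<close>

lemma code_swap_involutive:
  assumes "x \<noteq> y"
  shows "code_swap x y (code_swap x y c) = c"
proof (cases "c y < c x")
  case True
  then have "\<not> c x - 1 < c y"
    by simp
  with assms True show ?thesis
    by (simp add: code_swap_def fun_eq_iff)
qed (use assms in \<open>simp add: code_swap_def fun_eq_iff\<close>)

lemma code_swap_commute:
  assumes "x \<noteq> z" "x \<noteq> t" "y \<noteq> z" "y \<noteq> t"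
  shows "code_swap x y (code_swap z t c) = code_swap z t (code_swap x y c)"
proof -
  have upd: "c(x := a, y := b, z := d, t := e) = c(z := d, t := e, x := a, y := b)" for a b d e
    using assms by (auto simp: fun_eq_iff)
  show ?thesis
    using assms by (cases "c y < c x"; cases "c t < c z") (simp_all add: code_swap_def upd)
qed

lemma code_swap_braid:
  assumes "x \<noteq> y" "y \<noteq> z" "x \<noteq> z"
  shows "code_swap x y (code_swap y z (code_swap x y c)) =
    code_swap y z (code_swap x y (code_swap y z c))"
proof -
  \<comment> \<open>Naming the three affected entries leaves a finite case split. Swaps shift
    entries by one, hence the comparisons with \<open>p - 1\<close> and
    \<open>Suc r\<close>.\<close>
  have aux: "code_swap x y (code_swap y z (code_swap x y d)) =
    code_swap y z (code_swap x y (code_swap y z d))" if "d = c(x := p, y := q, z := r)" for d p q r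
    using assms unfolding that
    by (cases "q < p"; cases "r < p"; cases "r < q"; cases "r < p - 1"; cases "Suc r < p"; cases "Suc r < q")
     (auto simp: code_swap_def fun_eq_iff)
  show ?thesis
    using aux[of c "c x" "c y" "c z"] by simp
qed

lemma sum_code_swap:
  assumes "finite A" "x \<in> A" "y \<in> A" "x \<noteq> y"
  shows "c y < c x \<Longrightarrow> Suc (sum (code_swap x y c) A) = sum c A"
    and "\<not> c y < c x \<Longrightarrow> sum (code_swap x y c) A = Suc (sum c A)"
proof -
  have split: "sum f A = f x + (f y + sum f (A - {x} - {y}))" for f :: "'a \<Rightarrow> nat"
    using assms sum.remove[of A x f] sum.remove[of "A - {x}" y f] by simp
  have rest: "sum (code_swap x y c) (A - {x} - {y}) = sum c (A - {x} - {y})"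
    by (rule sum.cong) (auto simp: code_swap_def)
  show "Suc (sum (code_swap x y c) A) = sum c A" if "c y < c x"
    using that assms(4) unfolding split[of c] split[of "code_swap x y c"] rest
    by (simp add: code_swap_def)
  show "sum (code_swap x y c) A = Suc (sum c A)" if "\<not> c y < c x"
    using that assms(4) unfolding split[of c] split[of "code_swap x y c"] rest
    by (simp add: code_swap_def)
qed

section \<open>Cyclic indices and the action of words on codes\<close>

lemma next_idx_le: "next_idx k i \<le> k"
  unfolding next_idx_def by (metis lessI less_Suc_eq_le mod_less_divisor zero_less_Suc)

lemma next_idx_if: "i \<le> k \<Longrightarrow> next_idx k i = (if i = k then 0 else Suc i)"
  by (auto simp: next_idx_def)

lemma next_idx_inj: "i \<le> k \<Longrightarrow> j \<le> k \<Longrightarrow> next_idx k i = next_idx k j \<Longrightarrow> i = j"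
  by (auto simp: next_idx_if split: if_splits)

lemma next_idx_neq: "1 \<le> k \<Longrightarrow> i \<le> k \<Longrightarrow> next_idx k i \<noteq> i"
  by (auto simp: next_idx_if)

lemma next_idx_twice_neq: "2 \<le> k \<Longrightarrow> i \<le> k \<Longrightarrow> next_idx k (next_idx k i) \<noteq> i"
  by (auto simp: next_idx_if)

definition act :: "nat \<Rightarrow> nat list \<Rightarrow> (nat \<Rightarrow> nat) \<Rightarrow> nat \<Rightarrow> nat" where
  "act k u = foldr (\<lambda>i. code_swap i (next_idx k i)) u"

text \<open>The zero function is the code of the identity. The last letter acts first, so prepending
  a letter is left multiplication by a generator.\<close>

definition code :: "nat \<Rightarrow> nat list \<Rightarrow> nat \<Rightarrow> nat" where
  "code k u = act k u (\<lambda>_. 0)"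

definition weight :: "nat \<Rightarrow> (nat \<Rightarrow> nat) \<Rightarrow> nat" where
  "weight k c = sum c {0..k}"

lemma act_simps [simp]:
  "act k [] c = c"
  "act k (i # u) c = code_swap i (next_idx k i) (act k u c)"
  "act k (u @ v) c = act k u (act k v c)"
  by (simp_all add: act_def)

lemma code_simps [simp]:
  "code k [] = (\<lambda>_. 0)"
  "code k (i # u) = code_swap i (next_idx k i) (code k u)"
  by (simp_all add: code_def)

lemma code_append: "code k (u @ v) = act k u (code k v)"
  by (simp add: code_def)

context
  fixes k :: nat
  assumes k_pos: "1 \<le> k"
begin

text \<open>Each Coxeter relation becomes one of the identities for \<open>code_swap\<close>, so the
  action depends only on the group element.\<close>

lemma act_word_eq: "word_eq k u v \<Longrightarrow> act k u c = act k v c"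
proof (induction arbitrary: c rule: word_eq.induct)
  case (square i)
  then show ?case
    using next_idx_neq[OF k_pos square] by (simp add: code_swap_involutive)
next
  case (braid i j)
  then show ?case
    using next_idx_neq[OF k_pos, of i] next_idx_neq[OF k_pos, of j] next_idx_le[of k i]
      next_idx_twice_neq[of k i]
    by (auto intro!: code_swap_braid)
next
  case (comm i j)
  then show ?case
    \<comment> \<open>The relation admits \<open>i = j\<close>, where both sides coincide; otherwise
      injectivity of \<open>next_idx\<close> makes the two pairs of positions disjoint.\<close>
    using next_idx_inj[of i k j] by (cases "i = j") (auto intro!: code_swap_commute)
qed auto

lemma code_word_eq: "word_eq k u v \<Longrightarrow> code k u = code k v"
  by (simp add: code_def act_word_eq)

section \<open>Weights, descents and lengths\<close>

lemma weight_code_swap: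
  assumes "i \<le> k"
  shows "c (next_idx k i) < c i \<Longrightarrow> Suc (weight k (code_swap i (next_idx k i) c)) = weight k c"
    and "\<not> c (next_idx k i) < c i \<Longrightarrow> weight k (code_swap i (next_idx k i) c) = Suc (weight k c)"
  using sum_code_swap[of "{0..k}" i "next_idx k i" c] next_idx_neq[OF k_pos assms]
    next_idx_le[of k i] assms by (auto simp: weight_def)

text \<open>A letter raises the weight by at most one. Equality therefore means that no letter of
  \<open>d\<close> is a descent when its turn comes.\<close>

lemma weight_act_le: "set d \<subseteq> {0..k} \<Longrightarrow> weight k (act k d c) \<le> length d + weight k c"
proof (induction d)
  case (Cons i d)
  then show ?case
    using weight_code_swap[of i "act k d c"]
    by (cases "act k d c (next_idx k i) < act k d c i") auto
qed simp

lemma weight_code_le: "set u \<subseteq> {0..k} \<Longrightarrow> weight k (code k u) \<le> length u"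
  using weight_act_le[of u "\<lambda>_. 0"] by (simp add: code_def weight_def)

lemma word_eq_Cons: "i \<le> k \<Longrightarrow> word_eq k u v \<Longrightarrow> word_eq k (i # u) (i # v)"
  using word_eq.append[of k "[i]" "[i]" u v] by (simp add: word_eq.refl)

lemma word_eq_append_left: "word_eq k u v \<Longrightarrow> set w \<subseteq> {0..k} \<Longrightarrow> word_eq k (u @ w) (v @ w)"
  by (simp add: word_eq.append word_eq.refl)

lemma word_eq_set: "word_eq k u v \<Longrightarrow> set u \<subseteq> {0..k} \<and> set v \<subseteq> {0..k}"
  using word_eq_lists by (auto simp: in_lists_conv_set)

text \<open>If \<open>u\<close> starts with \<open>j\<close> and \<open>i \<noteq> j\<close> is another descent, then the longest word in \<open>i\<close> and \<open>j\<close> can be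
  split off from the left, and the Coxeter relation for it exchanges \<open>j\<close> and \<open>i\<close>.\<close>

lemma exchange:
  assumes "set u \<subseteq> {0..k}" "weight k (code k u) = length u"
    and "i \<le> k" "code k u (next_idx k i) < code k u i"
  shows "\<exists>v. word_eq k u (i # v) \<and> length u = Suc (length v)"
  using assms
proof (induction "length u" arbitrary: u i rule: less_induct)
  case less
  let ?n = "next_idx k"
  \<comment> \<open>The induction hypothesis in a form that can be iterated: the remaining word
    \<open>y\<close> is again reduced and its code is known.\<close>
  have strip: "\<exists>y. word_eq k x (l # y) \<and> length x = Suc (length y) \<and>
      code k y = code_swap l (?n l) (code k x) \<and> weight k (code k y) = length y"
    if x: "set x \<subseteq> {0..k}" "weight k (code k x) = length x" "length x < length u"
      and l: "l \<le> k" "code k x (?n l) < code k x l" for x l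
  proof -
    obtain y where y: "word_eq k x (l # y)" "length x = Suc (length y)"
      using less.hyps[OF x(3) x(1,2) l] by blast
    have cx: "code k x = code_swap l (?n l) (code k y)"
      using code_word_eq[OF y(1)] by simp
    have "code k y = code_swap l (?n l) (code k x)"
      using next_idx_neq[OF k_pos l(1)] by (simp add: cx code_swap_involutive)
    moreover have "weight k (code k y) = length y"
      using weight_code_swap(1)[OF l(1), of "code k x"] l(2) x(2) y(2) calculation by simp
    ultimately show ?thesis
      using y by blast
  qed
  obtain j x where u: "u = j # x"
    using less.prems by (cases u) auto
  have j: "j \<le> k" "set x \<subseteq> {0..k}"
    using less.prems u by auto
  \<comment> \<open>Since \<open>j # x\<close> has as many letters as its weight, the letter
    \<open>j\<close> must have raised the weight, and \<open>x\<close> has as many letters as its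
    own weight.\<close>
  have desc_j: "\<not> code k x (?n j) < code k x j" and wx: "weight k (code k x) = length x"
    using less.prems(2) weight_code_swap[OF j(1), of "code k x"] weight_code_le[OF j(2)]
    by (cases "code k x (?n j) < code k x j"; simp add: u)+
  have cx: "code k x = code_swap j (?n j) (code k u)"
    using next_idx_neq[OF k_pos j(1)] by (simp add: u code_swap_involutive)
  have dj: "code k u (?n j) < code k u j"
    using desc_j next_idx_neq[OF k_pos j(1)] by (simp add: u code_swap_def)
  have lx: "length x < length u"
    by (simp add: u)
  define c where "c = code k u"
  note di = less.prems(4)
  have nle: "?n a \<le> k" for a
    by (rule next_idx_le)
  \<comment> \<open>The letters are equal, commute, or are neighbours on one side or on both sides
    of the cycle.\<close>
  consider "i = j" | "i \<noteq> j" "j \<noteq> ?n i" "i \<noteq> ?n j" | "j = ?n i" "i \<noteq> ?n j"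
    | "i = ?n j" "j \<noteq> ?n i" | "j = ?n i" "i = ?n j"
    by blast
  then show ?case
  proof cases
    case 1
    then show ?thesis
      using u word_eq.refl[of u k] less.prems(1) by auto
  next
    case 2
    have "?n i \<noteq> ?n j"
      using next_idx_inj[of i k j] 2 j less.prems by auto
    then have "code k x (?n i) < code k x i"
      using di 2 by (auto simp: cx code_swap_def)
    then obtain y where y: "word_eq k x (i # y)" "length x = Suc (length y)"
      using strip[OF j(2) wx lx less.prems(3)] by blast
    have sy: "set y \<subseteq> {0..k}"
      using word_eq_set[OF y(1)] by simp
    have "word_eq k u (j # i # y)"
      using word_eq_Cons[OF j(1) y(1)] u by simp
    moreover have "word_eq k (j # i # y) (i # j # y)"
      using word_eq_append_left[OF word_eq.comm[of j k i] sy] j 2 less.prems(3) by simp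
    ultimately show ?thesis
      using y u by (intro exI[of _ "j # y"]) (auto intro: word_eq.trans)
  next
    case 3
    have k2: "2 \<le> k"
      using 3 j k_pos less.prems(3) by (auto simp: next_idx_if split: if_splits)
    have neq: "i \<noteq> j" "j \<noteq> ?n j" "i \<noteq> ?n j"
      using next_idx_neq[OF k_pos] 3 j less.prems(3) by metis+
    \<comment> \<open>The entries at \<open>i\<close>, \<open>j\<close>, \<open>?n j\<close>
      strictly decrease. This makes \<open>i\<close> a descent of \<open>x\<close>, and then
      \<open>j\<close> a descent of what remains, so \<open>j i j\<close> splits off and the braid
      relation applies.\<close>
    have cc: "c (?n j) < c j" "c j < c i"
      using di dj 3 by (auto simp: c_def)
    have "code k x (?n i) < code k x i"
      using cc neq 3 by (auto simp: cx code_swap_def c_def[symmetric])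
    then obtain y where y: "word_eq k x (i # y)" "length x = Suc (length y)"
        "code k y = code_swap i (?n i) (code k x)" "weight k (code k y) = length y"
      using strip[OF j(2) wx lx less.prems(3)] by blast
    have sy: "set y \<subseteq> {0..k}"
      using word_eq_set[OF y(1)] by simp
    have "code k y (?n j) < code k y j"
      using cc neq 3 unfolding y(3) cx c_def[symmetric] by (auto simp: code_swap_def)
    then obtain z where z: "word_eq k y (j # z)" "length y = Suc (length z)"
      using strip[OF sy y(4) _ j(1)] y(2) lx by force
    have sz: "set z \<subseteq> {0..k}"
      using word_eq_set[OF z(1)] by simp
    have "word_eq k u (j # i # j # z)"
      using word_eq_Cons[OF j(1) word_eq.trans[OF y(1) word_eq_Cons[OF less.prems(3) z(1)]]] u
      by simp
    moreover have "word_eq k (j # i # j # z) (i # j # i # z)"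
      using word_eq_append_left[OF word_eq.sym[OF word_eq.braid[OF k2 less.prems(3) 3(1)]] sz]
      by simp
    ultimately show ?thesis
      using y z u by (intro exI[of _ "j # i # z"]) (auto intro: word_eq.trans)
  next
    case 4
    have k2: "2 \<le> k"
      using 4 j k_pos less.prems(3) by (auto simp: next_idx_if split: if_splits)
    have neq: "i \<noteq> j" "i \<noteq> ?n i" "j \<noteq> ?n i"
      using next_idx_neq[OF k_pos] 4 j less.prems(3) by metis+
    have cc: "c (?n i) < c i" "c i < c j"
      using di dj 4 by (auto simp: c_def)
    have "code k x (?n i) < code k x i"
      using cc neq 4 by (auto simp: cx code_swap_def c_def[symmetric])
    then obtain y where y: "word_eq k x (i # y)" "length x = Suc (length y)"
        "code k y = code_swap i (?n i) (code k x)" "weight k (code k y) = length y"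
      using strip[OF j(2) wx lx less.prems(3)] by blast
    have sy: "set y \<subseteq> {0..k}"
      using word_eq_set[OF y(1)] by simp
    have "code k y (?n j) < code k y j"
      using cc neq 4 unfolding y(3) cx c_def[symmetric] by (auto simp: code_swap_def)
    then obtain z where z: "word_eq k y (j # z)" "length y = Suc (length z)"
      using strip[OF sy y(4) _ j(1)] y(2) lx by force
    have sz: "set z \<subseteq> {0..k}"
      using word_eq_set[OF z(1)] by simp
    have "word_eq k u (j # i # j # z)"
      using word_eq_Cons[OF j(1) word_eq.trans[OF y(1) word_eq_Cons[OF less.prems(3) z(1)]]] u
      by simp
    moreover have "word_eq k (j # i # j # z) (i # j # i # z)"
      using word_eq_append_left[OF word_eq.braid[OF k2 j(1) 4(1)] sz]
      by simp
    ultimately show ?thesis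
      using y z u by (intro exI[of _ "j # i # z"]) (auto intro: word_eq.trans)
  next
    \<comment> \<open>Neighbours on both sides occur only for \<open>k = 1\<close>. There the two
      descents contradict each other, so no braid relation is called for.\<close>
    case 5
    then show ?thesis
      using di dj by auto
  qed
qed

text \<open>A letter prepended to a reduced word either raises the weight, and the word stays
  reduced, or is a descent; then the exchange property brings the same letter to the front and the
  two cancel.\<close>

lemma reduced_word_exists:
  "set u \<subseteq> {0..k} \<Longrightarrow> \<exists>v. word_eq k u v \<and> length v = weight k (code k u)"
proof (induction u)
  case Nil
  then show ?case
    by (auto simp: weight_def intro: word_eq.refl)
next
  case (Cons i u)
  then obtain v where v: "word_eq k u v" "length v = weight k (code k u)"
    by auto
  have i: "i \<le> k" and sv: "set v \<subseteq> {0..k}"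
    using Cons word_eq_set[OF v(1)] by auto
  have cv: "code k v = code k u"
    using code_word_eq[OF v(1)] by simp
  have iv: "word_eq k (i # u) (i # v)"
    by (rule word_eq_Cons[OF i v(1)])
  show ?case
  proof (cases "code k u (next_idx k i) < code k u i")
    case True
    then obtain y where y: "word_eq k v (i # y)" "length v = Suc (length y)"
      using exchange[OF sv _ i] v cv by auto
    have sy: "set y \<subseteq> {0..k}"
      using word_eq_set[OF y(1)] by simp
    have "word_eq k (i # v) (i # i # y)"
      by (rule word_eq_Cons[OF i y(1)])
    moreover have "word_eq k (i # i # y) y"
      using word_eq_append_left[OF word_eq.square[OF i] sy] by simp
    ultimately have "word_eq k (i # u) y"
      using iv by (blast intro: word_eq.trans)
    moreover have "length y = weight k (code k (i # u))"
      using weight_code_swap(1)[OF i, of "code k u"] True y(2) v(2) by simp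
    ultimately show ?thesis
      by blast
  next
    case False
    then show ?thesis
      using iv v(2) weight_code_swap(2)[OF i, of "code k u"] by (intro exI[of _ "i # v"]) simp
  qed
qed

text \<open>The exchange property needs a reduced word, so \<open>u\<close> is first replaced by
  one; the code of the rest follows as swaps are involutions.\<close>

lemma strip_descent:
  assumes "set u \<subseteq> {0..k}" "i \<le> k" "code k u (next_idx k i) < code k u i"
  shows "\<exists>v. word_eq k u (i # v) \<and> code k v = code_swap i (next_idx k i) (code k u)"
proof -
  obtain u' where u': "word_eq k u u'" "length u' = weight k (code k u)"
    using reduced_word_exists[OF assms(1)] by blast
  have c: "code k u' = code k u"
    using code_word_eq[OF u'(1)] by simp
  obtain v where v: "word_eq k u' (i # v)"
    using exchange[of u' i] word_eq_set[OF u'(1)] u'(2) assms c by auto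
  have "code k u = code_swap i (next_idx k i) (code k v)"
    using code_word_eq[OF v] c by simp
  then show ?thesis
    using word_eq.trans[OF u'(1) v] next_idx_neq[OF k_pos assms(2)]
    by (auto simp: code_swap_involutive)
qed

text \<open>A swap carries a smallest of its two entries over unchanged, so a zero survives. Its
  position later serves as the point where the cycle of indices is cut open.\<close>

lemma code_has_zero: "set u \<subseteq> {0..k} \<Longrightarrow> \<exists>z\<le>k. code k u z = 0"
proof (induction u)
  case (Cons i u)
  then obtain z where z: "z \<le> k" "code k u z = 0"
    by auto
  have n: "next_idx k i \<le> k" "next_idx k i \<noteq> i" "i \<le> k"
    using Cons next_idx_le next_idx_neq[OF k_pos] by auto
  show ?case
  proof (cases "z = i \<or> z = next_idx k i")
    case True
    then have "code k (i # u) i = 0 \<or> code k (i # u) (next_idx k i) = 0"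
      using z n by (auto simp: code_swap_def)
    then show ?thesis
      using n by blast
  next
    case False
    then have "code k (i # u) z = 0"
      using z by (simp add: code_swap_def)
    then show ?thesis
      using z by blast
  qed
qed auto

end

section \<open>Zero-one matrices with given margins\<close>

text \<open>The \<open>r\<close>-th row is given by the set \<open>R r\<close> of the columns of its ones.\<close>

definition margins :: "nat \<Rightarrow> nat \<Rightarrow> (nat \<Rightarrow> nat set) \<Rightarrow> (nat \<Rightarrow> nat) \<Rightarrow> (nat \<Rightarrow> nat) \<Rightarrow> bool" where
  "margins k n R \<alpha> c \<longleftrightarrow> (\<forall>r<n. R r \<subseteq> {0..k} \<and> card (R r) = \<alpha> r) \<and>
    (\<forall>j\<le>k. (\<Sum>r<n. of_bool (j \<in> R r)) = c j)"

text \<open>Taking preimages of the rows under the bijection \<pi> keeps their sizes and rearranges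
  the columns. This absorbs the permutation of the code caused by a factor.\<close>

lemma margins_permute:
  assumes "margins k n R \<alpha> c" "bij_betw \<pi> {0..k} {0..k}"
  shows "\<exists>R'. margins k n R' \<alpha> (\<lambda>j. c (\<pi> j))"
proof -
  have inj: "inj_on \<pi> {0..k}" and img: "\<pi> ` {0..k} = {0..k}"
    using assms(2) by (auto simp: bij_betw_def)
  define R' where "R' r = {j \<in> {0..k}. \<pi> j \<in> R r}" for r
  have "card (R' r) = card (R r)" if "r < n" for r
  proof -
    have "R r \<subseteq> {0..k}"
      using assms(1) that by (auto simp: margins_def)
    then have "R r \<subseteq> \<pi> ` {0..k}"
      using img by simp
    then have "\<pi> ` R' r = R r"
      unfolding R'_def by blast
    moreover have "inj_on \<pi> (R' r)"
      by (rule inj_on_subset[OF inj]) (auto simp: R'_def)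
    ultimately show ?thesis
      by (metis card_image)
  qed
  moreover have "\<pi> j \<le> k" if "j \<le> k" for j
    using bij_betwE[OF assms(2)] that by simp
  ultimately have "margins k n R' \<alpha> (\<lambda>j. c (\<pi> j))"
    using assms(1) by (auto simp: margins_def R'_def)
  then show ?thesis by blast
qed

text \<open>Column \<open>j\<close> loses a one in row \<open>a\<close> and gains one in row
  \<open>b\<close>, so its sum stays. As \<open>j\<close> lies in \<open>R a\<close>, the truncated
  subtraction is exact.\<close>

lemma margins_move:
  assumes "margins k n R \<alpha> c" "a < n" "b < n" "a \<noteq> b" "j \<in> R a" "j \<notin> R b"
  shows "margins k n (R(a := R a - {j}, b := insert j (R b)))
    (\<alpha>(a := \<alpha> a - 1, b := Suc (\<alpha> b))) c"
proof -
  let ?R = "R(a := R a - {j}, b := insert j (R b))"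
  have rows: "R r \<subseteq> {0..k}" "card (R r) = \<alpha> r" if "r < n" for r
    using assms(1) that by (auto simp: margins_def)
  have fin: "finite (R r)" if "r < n" for r
    using rows[OF that] by (meson finite_atLeastAtMost finite_subset)
  have set: "{..<n} = insert a (insert b ({..<n} - {a, b}))"
    using assms by auto
  have split: "sum f {..<n} = f a + f b + sum f ({..<n} - {a, b})" for f :: "nat \<Rightarrow> nat"
    by (subst set) (use assms in simp)
  have "(\<Sum>r<n. of_bool (l \<in> ?R r)) = (\<Sum>r<n. of_bool (l \<in> R r) :: nat)" for l
  proof -
    have "(\<Sum>r\<in>{..<n} - {a, b}. of_bool (l \<in> ?R r)) =
        (\<Sum>r\<in>{..<n} - {a, b}. of_bool (l \<in> R r) :: nat)"
      by (rule sum.cong) auto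
    then show ?thesis
      using assms by (simp only: split) auto
  qed
  moreover have "j \<le> k"
    using rows(1)[OF assms(2)] assms(5) by auto
  ultimately show ?thesis
    using assms rows fin unfolding margins_def by auto
qed

lemma ex_less_of_sum_less:
  fixes f g :: "'a \<Rightarrow> nat"
  assumes "sum f A < sum g A"
  shows "\<exists>a\<in>A. f a < g a"
  by (rule ccontr) (use sum_mono[of A g f] assms in \<open>auto simp: not_less\<close>)

text \<open>Moving an entry from the surplus row \<open>i\<close> to a row \<open>b\<close>, so that \<open>R\<close> comes closer to \<open>Q\<close>, either
  is the required exchange or makes \<open>b\<close> a surplus row from which to continue.\<close>

lemma margins_exchange:
  assumes "margins k n R \<alpha> c" "margins k n Q \<beta> c" "i < n" "\<beta> i < \<alpha> i"
  shows "\<exists>j<n. \<alpha> j < \<beta> j \<and> (\<exists>R'. margins k n R' (\<alpha>(i := \<alpha> i - 1, j := Suc (\<alpha> j))) c)"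
  using assms
proof (induction "\<Sum>r<n. card (R r - Q r)" arbitrary: R \<alpha> i rule: less_induct)
  case less
  have R: "R r \<subseteq> {0..k}" "card (R r) = \<alpha> r" and Q: "Q r \<subseteq> {0..k}" "card (Q r) = \<beta> r"
    if "r < n" for r
    using less.prems that by (auto simp: margins_def)
  have fin: "finite (R r)" "finite (Q r)" if "r < n" for r
    using R(1)[OF that] Q(1)[OF that] by (meson finite_atLeastAtMost finite_subset)+
  have "\<not> R i \<subseteq> Q i"
    using card_mono[OF fin(2)[OF less.prems(3)], of "R i"] R[OF less.prems(3)] Q[OF less.prems(3)]
      less.prems(4) by auto
  then obtain j where j: "j \<in> R i" "j \<notin> Q i"
    by auto
  have "j \<le> k"
    using j R[OF less.prems(3)] by auto
  \<comment> \<open>Column \<open>j\<close> has the same sum in both matrices, but row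
    \<open>i\<close> contributes to it only in \<open>R\<close>; some other row \<open>b\<close>
    must contribute only in \<open>Q\<close>.\<close>
  have "(\<Sum>r<n. of_bool (j \<in> R r)) = (\<Sum>r<n. of_bool (j \<in> Q r) :: nat)"
    using less.prems \<open>j \<le> k\<close> by (simp add: margins_def)
  moreover have "sum f {..<n} = f i + sum f ({..<n} - {i})" for f :: "nat \<Rightarrow> nat"
    using less.prems(3) by (simp add: sum.remove)
  ultimately have "(\<Sum>r\<in>{..<n} - {i}. of_bool (j \<in> R r)) < (\<Sum>r\<in>{..<n} - {i}. of_bool (j \<in> Q r) :: nat)"
    using j by simp
  then obtain b where "b \<in> {..<n} - {i}" "of_bool (j \<in> R b) < (of_bool (j \<in> Q b) :: nat)"
    using ex_less_of_sum_less by blast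
  then have b: "b < n" "b \<noteq> i" "j \<notin> R b" "j \<in> Q b"
    by (auto simp: of_bool_def split: if_splits)
  let ?R = "R(i := R i - {j}, b := insert j (R b))"
  let ?\<alpha> = "\<alpha>(i := \<alpha> i - 1, b := Suc (\<alpha> b))"
  have m: "margins k n ?R ?\<alpha> c"
    using margins_move[OF less.prems(1,3) b(1)] b j by auto
  show ?case
  proof (cases "\<alpha> b < \<beta> b")
    case True
    then show ?thesis
      using m b(1) by blast
  next
    case False
    \<comment> \<open>The measure drops: the one removed from row \<open>i\<close> lies outside
      \<open>Q i\<close>, and the one added to row \<open>b\<close> lies inside
      \<open>Q b\<close>.\<close>
    have "(\<Sum>r<n. card (?R r - Q r)) < (\<Sum>r<n. card (R r - Q r))"
    proof (rule sum_strict_mono_ex1)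
      have "R i - {j} - Q i \<subset> R i - Q i"
        using j by auto
      then have "card (R i - {j} - Q i) < card (R i - Q i)"
        using fin[OF less.prems(3)] by (intro psubset_card_mono) auto
      then show "\<exists>r\<in>{..<n}. card (?R r - Q r) < card (R r - Q r)"
        using less.prems(3) b by auto
      show "\<forall>r\<in>{..<n}. card (?R r - Q r) \<le> card (R r - Q r)"
        using fin b by (auto intro!: card_mono)
    qed simp
    moreover have "\<beta> b < ?\<alpha> b"
      using False by simp
    ultimately obtain l R' where l: "l < n" "?\<alpha> l < \<beta> l"
        "margins k n R' (?\<alpha>(b := ?\<alpha> b - 1, l := Suc (?\<alpha> l))) c"
      using less.hyps[OF _ m less.prems(2) b(1)] by blast
    \<comment> \<open>After the move, row \<open>b\<close> is in surplus and row \<open>i\<close>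
      still has at least \<beta> \<open>i\<close> ones, so neither is in deficit. The continuation
      then takes back the one given to row \<open>b\<close>.\<close>
    have "l \<noteq> b" "l \<noteq> i"
      using l(2) False less.prems(4) b(2) by (auto split: if_splits)
    then have "?\<alpha>(b := ?\<alpha> b - 1, l := Suc (?\<alpha> l)) = \<alpha>(i := \<alpha> i - 1, l := Suc (\<alpha> l))"
      using b(2) by (auto simp: fun_eq_iff)
    then show ?thesis
      using l \<open>l \<noteq> b\<close> \<open>l \<noteq> i\<close> by (intro exI[of _ l]) auto
  qed
qed

text \<open>If the first row has a one in column \<open>j\<close> outside \<open>S\<close> and none
  in column \<open>i\<close> of \<open>S\<close>, then \<open>c j \<le> c i\<close> yields a later
  row with the opposite pattern. Exchanging the two patterns keeps all margins and brings the first
  row closer to \<open>S\<close>.\<close>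

lemma margins_first_row:
  assumes "margins k (Suc n) R \<alpha> c" "S \<subseteq> {0..k}" "card S = \<alpha> 0"
    and "\<And>i j. i \<in> S \<Longrightarrow> j \<in> {0..k} - S \<Longrightarrow> c j \<le> c i"
  shows "\<exists>R'. R' 0 = S \<and> margins k (Suc n) R' \<alpha> c"
  using assms(1)
proof (induction "card (S - R 0)" arbitrary: R rule: less_induct)
  case less
  have R0: "R 0 \<subseteq> {0..k}" "card (R 0) = card S"
    using less.prems assms(3) by (auto simp: margins_def)
  have fin: "finite (R 0)" "finite S"
    using R0(1) assms(2) by (meson finite_atLeastAtMost finite_subset)+
  show ?case
  proof (cases "S \<subseteq> R 0")
    case True
    then show ?thesis
      using card_subset_eq[OF fin(1)] R0(2) less.prems by metis
  next
    case False
    then obtain i where i: "i \<in> S" "i \<notin> R 0"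
      by auto
    have "\<not> R 0 \<subseteq> S"
      using card_subset_eq[OF fin(2)] R0(2) i by metis
    then obtain j where j: "j \<in> R 0" "j \<notin> S"
      by auto
    have ij: "i \<le> k" "j \<le> k" "i \<noteq> j"
      using i j R0 assms(2) by auto
    have "c j \<le> c i"
      using assms(4)[OF i(1)] j ij by auto
    moreover have "c l = of_bool (l \<in> R 0) + (\<Sum>r<n. of_bool (l \<in> R (Suc r)))" if "l \<le> k" for l
      using less.prems that by (simp add: margins_def sum.lessThan_Suc_shift del: sum.lessThan_Suc)
    ultimately have "(\<Sum>r<n. of_bool (j \<in> R (Suc r))) < (\<Sum>r<n. of_bool (i \<in> R (Suc r)) :: nat)"
      using i j ij by simp
    then obtain b where "b \<in> {..<n}" "of_bool (j \<in> R (Suc b)) < (of_bool (i \<in> R (Suc b)) :: nat)"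
      using ex_less_of_sum_less by blast
    then have b: "b < n" "i \<in> R (Suc b)" "j \<notin> R (Suc b)"
      by (auto simp: of_bool_def split: if_splits)
    let ?R = "R(Suc b := R (Suc b) - {i}, 0 := insert i (R 0))"
    let ?\<alpha> = "\<alpha>(Suc b := \<alpha> (Suc b) - 1, 0 := Suc (\<alpha> 0))"
    \<comment> \<open>The second move reverses the effect of the first on the row sums.\<close>
    let ?R' = "?R(0 := ?R 0 - {j}, Suc b := insert j (?R (Suc b)))"
    have m: "margins k (Suc n) ?R ?\<alpha> c"
      using b i by (intro margins_move[OF less.prems]) auto
    have "margins k (Suc n) ?R' (?\<alpha>(0 := ?\<alpha> 0 - 1, Suc b := Suc (?\<alpha> (Suc b)))) c"
      using b j by (intro margins_move[OF m]) auto
    \<comment> \<open>Positivity is needed because subtracting one and adding it back is the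
      identity only away from zero.\<close>
    moreover have "0 < \<alpha> (Suc b)"
    proof -
      have "R (Suc b) \<subseteq> {0..k}" "card (R (Suc b)) = \<alpha> (Suc b)"
        using less.prems b(1) by (auto simp: margins_def)
      then show ?thesis
        using b(2) by (metis card_gt_0_iff empty_iff finite_atLeastAtMost finite_subset)
    qed
    then have "?\<alpha>(0 := ?\<alpha> 0 - 1, Suc b := Suc (?\<alpha> (Suc b))) = \<alpha>"
      by (auto simp: fun_eq_iff)
    ultimately have "margins k (Suc n) ?R' \<alpha> c"
      by simp
    moreover have "card (S - ?R' 0) < card (S - R 0)"
    proof (rule psubset_card_mono)
      show "S - ?R' 0 \<subset> S - R 0"
        using i j by auto
    qed (use fin in simp)
    ultimately show ?thesis
      using less.hyps by blast
  qed
qed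

lemma margins_tail:
  assumes "margins k (Suc n) R \<alpha> c"
  shows "margins k n (\<lambda>r. R (Suc r)) (\<lambda>r. \<alpha> (Suc r)) (\<lambda>j. c j - of_bool (j \<in> R 0))"
proof -
  have "(\<Sum>r<n. of_bool (j \<in> R (Suc r))) = c j - of_bool (j \<in> R 0)" if "j \<le> k" for j
  proof -
    have "c j = of_bool (j \<in> R 0) + (\<Sum>r<n. of_bool (j \<in> R (Suc r)))"
      using assms that
      by (simp add: margins_def sum.lessThan_Suc_shift del: sum.lessThan_Suc sum_of_bool_eq)
    then show ?thesis
      by simp
  qed
  then show ?thesis
    using assms by (simp add: margins_def)
qed

lemma margins_Cons:
  assumes "margins k n R \<alpha> c" "S \<subseteq> {0..k}"
  shows "margins k (Suc n) (case_nat S R) (case_nat (card S) \<alpha>) (\<lambda>j. c j + of_bool (j \<in> S))"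
  unfolding margins_def
proof (intro conjI allI impI)
  fix r assume "r < Suc n"
  then show "case_nat S R r \<subseteq> {0..k}" and "card (case_nat S R r) = case_nat (card S) \<alpha> r"
    using assms by (cases r; simp add: margins_def)+
next
  fix j assume "j \<le> k"
  then show "(\<Sum>r<Suc n. of_bool (j \<in> case_nat S R r)) = c j + of_bool (j \<in> S)"
    using assms(1) unfolding sum.lessThan_Suc_shift by (simp add: margins_def)
qed

text \<open>Greedy choice: a remaining element of maximal value is added each time, and injectivity
  makes the comparisons strict.\<close>

lemma top_subset_exists:
  fixes f :: "'a \<Rightarrow> nat"
  assumes "finite A" "inj_on f A" "a \<le> card A"
  shows "\<exists>S\<subseteq>A. card S = a \<and> (\<forall>i\<in>S. \<forall>j\<in>A - S. f j < f i)"
  using assms(3)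
proof (induction a)
  case 0
  show ?case
    by (rule exI[of _ "{}"]) simp
next
  case (Suc a)
  then obtain S where S: "S \<subseteq> A" "card S = a" and top: "\<And>i j. i \<in> S \<Longrightarrow> j \<in> A - S \<Longrightarrow> f j < f i"
    by (metis Suc_leD)
  have finS: "finite S"
    using S(1) assms(1) by (rule finite_subset)
  have "A - S \<noteq> {}"
    using S Suc.prems by (metis Diff_eq_empty_iff Suc_n_not_le_n subset_antisym)
  then have "Max (f ` (A - S)) \<in> f ` (A - S)"
    using assms(1) by (intro Max_in) simp_all
  then obtain m where m: "m \<in> A - S" "f m = Max (f ` (A - S))"
    by (metis imageE)
  then have m: "m \<in> A - S" "\<And>j. j \<in> A - S \<Longrightarrow> f j \<le> f m"
    using assms(1) by simp_all
  have "f j < f m" if "j \<in> A - insert m S" for j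
  proof -
    have "f j \<le> f m" "f j \<noteq> f m"
      using m that inj_onD[OF assms(2), of j m] by blast+
    then show ?thesis
      by simp
  qed
  then have "\<forall>i\<in>insert m S. \<forall>j\<in>A - insert m S. f j < f i"
    using top by blast
  moreover have "card (insert m S) = Suc a" "insert m S \<subseteq> A"
    using S finS m(1) by simp_all
  ultimately show ?case
    by blast
qed

section \<open>Factorizations into cyclically decreasing words\<close>

lemma margins_cong:
  assumes "margins k n R \<alpha> c" "\<And>r. r < n \<Longrightarrow> \<alpha> r = \<beta> r" "\<And>j. j \<le> k \<Longrightarrow> c j = e j"
  shows "margins k n R \<beta> e"
  using assms by (simp add: margins_def)

definition cyc_word :: "nat \<Rightarrow> nat list \<Rightarrow> bool" where
  "cyc_word k d \<longleftrightarrow> set d \<subseteq> {0..k} \<and> distinct d \<and>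
    (\<forall>p<length d. \<forall>q<length d. d ! p = next_idx k (d ! q) \<longrightarrow> p < q)"

text \<open>For each \<open>i\<close> in \<open>S\<close>, the index
  \<open>(next_idx k ^^ m) i\<close> is the first one outside \<open>S\<close> met going forward.
  Stripping a run from its end carries the entry found there backwards, so every letter meets it as
  the right neighbour.\<close>

definition dominates_ahead :: "nat \<Rightarrow> (nat \<Rightarrow> nat) \<Rightarrow> nat set \<Rightarrow> bool" where
  "dominates_ahead k c S \<longleftrightarrow> (\<forall>i\<in>S. \<forall>m.
    (\<forall>l<m. (next_idx k ^^ l) i \<in> S) \<and> (next_idx k ^^ m) i \<notin> S \<longrightarrow> c ((next_idx k ^^ m) i) < c i)"

lemma next_idx_funpow: "i \<le> k \<Longrightarrow> (next_idx k ^^ m) i = (i + m) mod Suc k"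
  by (induction m) (simp_all add: next_idx_def mod_Suc_eq)

text \<open>A nonempty set closed under \<open>next_idx\<close> would contain the whole cycle, in
  particular \<open>z\<close>.\<close>

lemma exists_run_end:
  assumes "S \<subseteq> {0..k}" "S \<noteq> {}" "z \<le> k" "z \<notin> S"
  shows "\<exists>i\<in>S. next_idx k i \<notin> S"
proof (rule ccontr)
  assume closed: "\<not> (\<exists>i\<in>S. next_idx k i \<notin> S)"
  obtain i where "i \<in> S"
    using assms(2) by blast
  then have i: "i \<in> S" "i \<le> k"
    using assms(1) by auto
  have "(next_idx k ^^ m) i \<in> S" for m
    using closed i by (induction m) auto
  \<comment> \<open>This number of steps leads from \<open>i\<close> through a wrap-around to
    \<open>z\<close>.\<close>
  from this[of "Suc k - i + z"] have "(i + (Suc k - i + z)) mod Suc k \<in> S"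
    by (simp add: next_idx_funpow i)
  moreover have "i + (Suc k - i + z) = z + Suc k"
    using i by simp
  ultimately show False
    using assms(3,4) by (metis mod_add_self2 mod_less le_imp_less_Suc)
qed

text \<open>The position of \<open>j\<close>, counted from 0, in the cyclic order that starts just
  after \<open>z\<close> and ends with \<open>z\<close>.\<close>

definition gap_pos :: "nat \<Rightarrow> nat \<Rightarrow> nat \<Rightarrow> nat" where
  "gap_pos k z j = (if z < j then j - z - 1 else j + k - z)"

lemma gap_pos_le: "j \<le> k \<Longrightarrow> z \<le> k \<Longrightarrow> gap_pos k z j \<le> k"
  by (cases "z < j") (simp_all add: gap_pos_def)

lemma gap_pos_inj: "z \<le> k \<Longrightarrow> inj_on (gap_pos k z) {0..k}"
  by (rule inj_onI) (auto simp: gap_pos_def split: if_splits)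

lemma gap_pos_next:
  "j \<le> k \<Longrightarrow> z \<le> k \<Longrightarrow> j \<noteq> z \<Longrightarrow> gap_pos k z (next_idx k j) = Suc (gap_pos k z j)"
  by (auto simp: gap_pos_def next_idx_if)

text \<open>With \<open>p\<close> and \<open>q\<close> below the base \<open>Suc k\<close>, the keys
  order the pairs \<open>(a, p)\<close> and \<open>(b, q)\<close> lexicographically.\<close>

lemma lex_key_less:
  fixes a b p q :: nat
  assumes "a * Suc k + p < b * Suc k + q" "p \<le> k" "q \<le> k"
  shows "a \<le> b" "a = b \<Longrightarrow> p < q"
proof -
  show "a \<le> b"
  proof (rule ccontr)
    assume "\<not> a \<le> b"
    then have "Suc b * Suc k \<le> a * Suc k"
      by (intro mult_le_mono) simp_all
    with assms show False
      by simp
  qed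
qed (use assms in simp)

text \<open>Ties are broken in favour of the letters closest behind \<open>z\<close>, so that no letter left out
  follows an equal chosen one within a run.\<close>

lemma top_dominates_ahead:
  assumes "S \<subseteq> {0..k}" "z \<le> k" "z \<notin> S"
    and "\<And>i j. i \<in> S \<Longrightarrow> j \<in> {0..k} - S \<Longrightarrow>
      c j * Suc k + gap_pos k z j < c i * Suc k + gap_pos k z i"
  shows "dominates_ahead k c S"
  unfolding dominates_ahead_def
proof (intro ballI allI impI)
  fix i m
  assume i: "i \<in> S"
    and run: "(\<forall>l<m. (next_idx k ^^ l) i \<in> S) \<and> (next_idx k ^^ m) i \<notin> S"
  have ik: "i \<le> k"
    using i assms(1) by auto
  have le: "(next_idx k ^^ l) i \<le> k" for l
    by (cases l) (simp_all add: ik next_idx_le)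
  \<comment> \<open>The run avoids \<open>z\<close>, so \<open>gap_pos\<close> grows along it. Equal
    entries at \<open>i\<close> and at the end of the run would then contradict the order of the
    keys.\<close>
  have "l \<le> m \<Longrightarrow> gap_pos k z ((next_idx k ^^ l) i) = gap_pos k z i + l" for l
  proof (induction l)
    case (Suc l)
    then have "(next_idx k ^^ l) i \<noteq> z"
      using run assms(3) by auto
    then show ?case
      using Suc gap_pos_next[OF le assms(2)] by simp
  qed simp
  from this[of m] have "gap_pos k z i \<le> gap_pos k z ((next_idx k ^^ m) i)"
    by simp
  moreover have "c ((next_idx k ^^ m) i) * Suc k + gap_pos k z ((next_idx k ^^ m) i) <
      c i * Suc k + gap_pos k z i"
    using assms(4)[OF i] le run by simp
  note lex_key_less[OF this gap_pos_le[OF le assms(2)] gap_pos_le[OF ik assms(2)]]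
  ultimately show "c ((next_idx k ^^ m) i) < c i"
    by (metis le_neq_implies_less not_le)
qed

text \<open>The swap moves the entry at \<open>next_idx k i\<close> to \<open>i\<close> unchanged.
  Runs that ended just after \<open>i\<close> now end at \<open>i\<close> and are compared with the
  same entry; the others are not affected.\<close>

lemma dominates_ahead_strip:
  assumes "dominates_ahead k c S" "S \<subseteq> {0..k}" "i \<in> S" "next_idx k i \<notin> S"
  shows "dominates_ahead k (code_swap i (next_idx k i) c) (S - {i})"
  unfolding dominates_ahead_def
proof (intro ballI allI impI)
  fix j m
  let ?nx = "next_idx k" and ?c = "code_swap i (next_idx k i) c"
  assume j: "j \<in> S - {i}"
    and run: "(\<forall>l<m. (?nx ^^ l) j \<in> S - {i}) \<and> (?nx ^^ m) j \<notin> S - {i}"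
  have dom: "c ((?nx ^^ m) x) < c x"
    if "x \<in> S" "\<forall>l<m. (?nx ^^ l) x \<in> S" "(?nx ^^ m) x \<notin> S" for x m
    using assms(1) that unfolding dominates_ahead_def by blast
  have desc: "c (?nx i) < c i"
    using dom[of i 1] assms(3,4) by simp
  have ni: "?nx i \<noteq> i"
    using assms(3,4) by metis
  have cj: "?c j = c j"
  proof -
    have "j \<noteq> i" "j \<noteq> ?nx i"
      using j assms(4) by blast+
    then show ?thesis
      by (simp add: code_swap_def)
  qed
  show "?c ((?nx ^^ m) j) < ?c j"
  proof (cases "(?nx ^^ m) j = i")
    case True
    have "c ((?nx ^^ Suc m) j) < c j"
    proof (rule dom)
      show "\<forall>l<Suc m. (?nx ^^ l) j \<in> S"
        using run True assms(3) less_Suc_eq by blast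
      show "(?nx ^^ Suc m) j \<notin> S"
        using True assms(4) by simp
    qed (use j in simp)
    moreover have "?c i = c (?nx i)"
      using desc ni by (simp add: code_swap_def)
    ultimately show ?thesis
      unfolding True cj by (simp add: True)
  next
    case False
    have "c ((?nx ^^ m) j) < c j"
      by (rule dom) (use j run False in blast)+
    \<comment> \<open>By injectivity, \<open>?nx i\<close> can be reached from inside a run only
      through \<open>i\<close>, which has been removed.\<close>
    moreover have "(?nx ^^ m) j \<noteq> ?nx i"
    proof
      assume eq: "(?nx ^^ m) j = ?nx i"
      show False
      proof (cases m)
        case 0
        then show False
          using eq j assms(4) by simp
      next
        case (Suc l)
        then have in_S: "(?nx ^^ l) j \<in> S - {i}"
          using run by simp
        then have "(?nx ^^ l) j \<le> k" "i \<le> k"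
          using assms(2,3) by auto
        then have "(?nx ^^ l) j = i"
          using eq Suc by (metis next_idx_inj funpow.simps(2) comp_apply)
        then show False
          using in_S by simp
      qed
    qed
    ultimately show ?thesis
      using False cj by (simp add: code_swap_def)
  qed
qed

section \<open>Cyclically decreasing words acting on codes\<close>

context
  fixes k :: nat
  assumes k_pos: "1 \<le> k"
begin

lemma cyc_word_Nil [simp]: "cyc_word k []"
  by (simp add: cyc_word_def)

text \<open>Only comparisons with the first letter in the role of \<open>q\<close> add a condition:
  its successor would have to stand before it, so it cannot occur in \<open>d\<close>.\<close>

lemma cyc_word_Cons:
  "cyc_word k (i # d) \<longleftrightarrow>
    i \<le> k \<and> i \<notin> set d \<and> next_idx k i \<notin> set d \<and> cyc_word k d"
proof
  assume L: "cyc_word k (i # d)"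
  then have ord: "p < q" if "p < length (i # d)" "q < length (i # d)"
      "(i # d) ! p = next_idx k ((i # d) ! q)" for p q
    using that unfolding cyc_word_def by blast
  have "d ! p \<noteq> next_idx k i" if "p < length d" for p
    using ord[of "Suc p" 0] that by auto
  then have "next_idx k i \<notin> set d"
    by (metis in_set_conv_nth)
  moreover have "p < q" if "p < length d" "q < length d" "d ! p = next_idx k (d ! q)" for p q
    using ord[of "Suc p" "Suc q"] that by simp
  then have "\<forall>p<length d. \<forall>q<length d. d ! p = next_idx k (d ! q) \<longrightarrow> p < q"
    by blast
  moreover have "set (i # d) \<subseteq> {0..k}" "distinct (i # d)"
    using L unfolding cyc_word_def by blast+
  ultimately show "i \<le> k \<and> i \<notin> set d \<and> next_idx k i \<notin> set d \<and> cyc_word k d"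
    unfolding cyc_word_def by simp
next
  assume R: "i \<le> k \<and> i \<notin> set d \<and> next_idx k i \<notin> set d \<and> cyc_word k d"
  have "p < q" if "p < length (i # d)" "q < length (i # d)"
      "(i # d) ! p = next_idx k ((i # d) ! q)" for p q
  proof (cases q)
    case 0
    show ?thesis
    proof (cases p)
      case 0
      then show ?thesis
        using that(3) \<open>q = 0\<close> next_idx_neq[OF k_pos, of i] R by simp
    next
      case (Suc p')
      then have "next_idx k i \<in> set d"
        using that \<open>q = 0\<close> nth_mem[of p' d] by simp
      then show ?thesis
        using R by simp
    qed
  next
    case (Suc q')
    show ?thesis
    proof (cases p)
      case (Suc p')
      then have "p' < length d" "q' < length d" "d ! p' = next_idx k (d ! q')"
        using that \<open>q = Suc q'\<close> by simp_all
      then have "p' < q'"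
        using R unfolding cyc_word_def by blast
      then show ?thesis
        using Suc \<open>q = Suc q'\<close> by simp
    qed (use Suc in simp)
  qed
  then have "\<forall>p<length (i # d). \<forall>q<length (i # d).
      (i # d) ! p = next_idx k ((i # d) ! q) \<longrightarrow> p < q"
    by blast
  moreover have "set (i # d) \<subseteq> {0..k}" "distinct (i # d)"
    using R unfolding cyc_word_def by auto
  ultimately show "cyc_word k (i # d)"
    unfolding cyc_word_def by blast
qed

text \<open>Every letter \<open>i\<close> raises the weight, hence transposes the entries at
  \<open>i\<close> and its successor and adds one at \<open>i\<close>. Neither index occurs in
  \<open>d\<close>, so neither entry carries an earlier increment.\<close>

lemma act_cyc_word:
  assumes "cyc_word k d" "weight k (act k d c) = length d + weight k c"
  shows "\<exists>\<pi>. bij_betw \<pi> {0..k} {0..k} \<and>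
    (\<forall>j\<le>k. act k d c j = c (\<pi> j) + of_bool (j \<in> set d))"
  using assms
proof (induction d)
  case Nil
  show ?case
    by (rule exI[of _ id]) (simp add: bij_betw_def)
next
  case (Cons i d)
  let ?n = "next_idx k i"
  have i: "i \<le> k" "i \<notin> set d" "?n \<notin> set d" "cyc_word k d"
    using Cons.prems(1) by (simp_all add: cyc_word_Cons)
  have n: "?n \<le> k" "?n \<noteq> i"
    using next_idx_le next_idx_neq[OF k_pos i(1)] by auto
  have "weight k (act k d c) \<le> length d + weight k c"
    using weight_act_le[OF k_pos] i(4) by (simp add: cyc_word_def)
  then have asc: "\<not> act k d c ?n < act k d c i" and w: "weight k (act k d c) = length d + weight k c"
    using Cons.prems(2) weight_code_swap[OF k_pos i(1), of "act k d c"]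
    by (cases "act k d c ?n < act k d c i"; simp)+
  obtain \<pi> where \<pi>: "bij_betw \<pi> {0..k} {0..k}"
      "\<And>j. j \<le> k \<Longrightarrow> act k d c j = c (\<pi> j) + of_bool (j \<in> set d)"
    using Cons.IH[OF i(4) w] by blast
  define \<tau> where "\<tau> j = (if j = i then ?n else if j = ?n then i else j)" for j
  have "bij_betw \<tau> {0..k} {0..k}"
    by (rule bij_betw_byWitness[of _ \<tau>]) (use i n in \<open>auto simp: \<tau>_def\<close>)
  then have "bij_betw (\<pi> \<circ> \<tau>) {0..k} {0..k}"
    using \<pi>(1) by (rule bij_betw_trans)
  moreover have "act k (i # d) c j = c ((\<pi> \<circ> \<tau>) j) + of_bool (j \<in> set (i # d))" if "j \<le> k" for j
    using asc i n that \<pi>(2) by (simp add: code_swap_def \<tau>_def)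
  ultimately show ?case
    by blast
qed

text \<open>The last letter of a run of \<open>S\<close> is a descent and is stripped first; the
  condition passes to the remaining letters. Its successor lies outside \<open>S\<close>, so the
  resulting word is cyclically decreasing.\<close>

lemma strip_cyc_word:
  assumes "set u \<subseteq> {0..k}" "S \<subseteq> {0..k}" "z \<le> k" "z \<notin> S" "dominates_ahead k (code k u) S"
  shows "\<exists>d v. word_eq k u (d @ v) \<and> cyc_word k d \<and> set d = S \<and>
    weight k (code k u) = length d + weight k (code k v)"
  using assms
proof (induction "card S" arbitrary: S u)
  case 0
  then have "S = {}"
    using finite_subset by fastforce
  then show ?case
    using 0(2) by (intro exI[of _ "[]"] exI[of _ u]) (simp add: word_eq.refl)
next
  case (Suc s)
  obtain i where i: "i \<in> S" "next_idx k i \<notin> S"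
    using exists_run_end[OF Suc.prems(2) _ Suc.prems(3,4)] Suc.hyps(2) by fastforce
  have ik: "i \<le> k"
    using i Suc.prems(2) by auto
  have "\<forall>m. (\<forall>l<m. (next_idx k ^^ l) i \<in> S) \<and> (next_idx k ^^ m) i \<notin> S \<longrightarrow>
      code k u ((next_idx k ^^ m) i) < code k u i"
    using Suc.prems(5) i(1) by (simp add: dominates_ahead_def)
  from this[rule_format, of 1] have desc: "code k u (next_idx k i) < code k u i"
    using i by simp
  obtain v where v: "word_eq k u (i # v)" "code k v = code_swap i (next_idx k i) (code k u)"
    using strip_descent[OF k_pos Suc.prems(1) ik desc] by blast
  have sv: "set v \<subseteq> {0..k}"
    using word_eq_set[OF k_pos v(1)] by simp
  have "\<exists>d v'. word_eq k v (d @ v') \<and> cyc_word k d \<and> set d = S - {i} \<and>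
      weight k (code k v) = length d + weight k (code k v')"
  proof (rule Suc.hyps(1))
    show "s = card (S - {i})"
      using Suc.hyps(2) i(1) by simp
    show "dominates_ahead k (code k v) (S - {i})"
      unfolding v(2) by (rule dominates_ahead_strip[OF Suc.prems(5,2) i])
  qed (use sv Suc.prems in auto)
  then obtain d v' where d: "word_eq k v (d @ v')" "cyc_word k d" "set d = S - {i}"
      "weight k (code k v) = length d + weight k (code k v')"
    by blast
  have "word_eq k u ((i # d) @ v')"
    using word_eq.trans[OF v(1) word_eq_Cons[OF k_pos ik d(1)]] by simp
  moreover have "cyc_word k (i # d)"
    using d i ik by (simp add: cyc_word_Cons)
  moreover have "set (i # d) = S"
    using d(3) i(1) by auto
  moreover have "weight k (code k u) = length (i # d) + weight k (code k v')"
    using weight_code_swap(1)[OF k_pos ik desc] d(4) v(2) by simp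
  ultimately show ?case
    by blast
qed

text \<open>Each factor permutes the columns of the matrix built from the later factors and puts its
  set of letters on top as a new row.\<close>

lemma margins_of_factorization:
  assumes "\<forall>d\<in>set ds. cyc_word k d" "weight k (code k (concat ds)) = length (concat ds)"
  shows "\<exists>R. margins k (length ds) R (\<lambda>r. length (ds ! r)) (code k (concat ds))"
  using assms
proof (induction ds)
  case Nil
  show ?case
    by (simp add: margins_def)
next
  case (Cons d ds)
  let ?u = "concat ds"
  have d: "cyc_word k d" "set d \<subseteq> {0..k}" "card (set d) = length d"
    using Cons.prems by (simp_all add: cyc_word_def distinct_card)
  have su: "set ?u \<subseteq> {0..k}"
    using Cons.prems by (auto simp: cyc_word_def)
  have "weight k (act k d (code k ?u)) = length d + length ?u"
    using Cons.prems(2) by (simp add: code_append)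
  \<comment> \<open>The two upper bounds on the weights add up to an equality, so both are
    attained.\<close>
  then have w: "weight k (code k ?u) = length ?u"
      "weight k (act k d (code k ?u)) = length d + weight k (code k ?u)"
    using weight_act_le[OF k_pos d(2), of "code k ?u"] weight_code_le[OF k_pos su] by linarith+
  obtain R where R: "margins k (length ds) R (\<lambda>r. length (ds ! r)) (code k ?u)"
    using Cons.IH Cons.prems(1) w(1) by auto
  obtain \<pi> where \<pi>: "bij_betw \<pi> {0..k} {0..k}"
      "\<And>j. j \<le> k \<Longrightarrow> act k d (code k ?u) j = code k ?u (\<pi> j) + of_bool (j \<in> set d)"
    using act_cyc_word[OF d(1) w(2)] by blast
  obtain R' where R': "margins k (length ds) R' (\<lambda>r. length (ds ! r)) (\<lambda>j. code k ?u (\<pi> j))"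
    using margins_permute[OF R \<pi>(1)] by blast
  have "margins k (length (d # ds)) (case_nat (set d) R') (\<lambda>r. length ((d # ds) ! r))
      (code k (concat (d # ds)))"
    using margins_Cons[OF R' d(2)] unfolding length_Cons
  proof (rule margins_cong)
    fix r
    show "case_nat (card (set d)) (\<lambda>r. length (ds ! r)) r = length ((d # ds) ! r)"
      by (cases r) (simp_all add: d(3))
  qed (simp add: \<pi>(2) code_append)
  then show ?case
    by blast
qed

text \<open>The first row is moved to columns with the largest code entries, which are the letters
  of a factor that can be split off. The remaining rows, with columns permuted back, fit the code of
  the rest.\<close>

lemma factorization_of_margins:
  assumes "set u \<subseteq> {0..k}" "margins k n R \<alpha> (code k u)"
  shows "\<exists>ds. length ds = n \<and> (\<forall>r<n. cyc_word k (ds ! r) \<and> length (ds ! r) = \<alpha> r) \<and>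
    word_eq k u (concat ds) \<and> length (concat ds) = weight k (code k u)"
  using assms
proof (induction n arbitrary: u R \<alpha>)
  case 0
  then have "weight k (code k u) = 0"
    by (simp add: margins_def weight_def)
  then show ?case
    using reduced_word_exists[OF k_pos 0(1)] by auto
next
  case (Suc n)
  let ?c = "code k u"
  obtain z where z: "z \<le> k" "?c z = 0"
    using code_has_zero[OF k_pos Suc.prems(1)] by blast
  \<comment> \<open>Code entries come first and ties are broken by \<open>gap_pos\<close>, so the
    keys are distinct and the largest ones well determined.\<close>
  let ?key = "\<lambda>j. ?c j * Suc k + gap_pos k z j"
  have key: "?c i \<le> ?c j" if "?key i < ?key j" "i \<le> k" "j \<le> k" for i j
    using lex_key_less(1)[OF that(1)] gap_pos_le that z by blast
  have "inj_on ?key {0..k}"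
  proof (rule inj_onI)
    have key_mod: "?key j mod Suc k = gap_pos k z j" if "j \<le> k" for j
      using gap_pos_le[OF that z(1)] by (metis mod_mult_self3 mod_less le_imp_less_Suc)
    fix x y assume xy: "x \<in> {0..k}" "y \<in> {0..k}" "?key x = ?key y"
    then have "gap_pos k z x = gap_pos k z y"
      using key_mod[of x] key_mod[of y] by (metis atLeastAtMost_iff)
    then show "x = y"
      using gap_pos_inj[OF z(1)] xy by (simp add: inj_on_eq_iff)
  qed
  moreover have "\<alpha> 0 \<le> card {0..k}"
  proof -
    have "R 0 \<subseteq> {0..k}" "card (R 0) = \<alpha> 0"
      using Suc.prems(2) by (auto simp: margins_def)
    then show ?thesis
      by (metis card_mono finite_atLeastAtMost)
  qed
  ultimately obtain S where S: "S \<subseteq> {0..k}" "card S = \<alpha> 0"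
      "\<forall>i\<in>S. \<forall>j\<in>{0..k} - S. ?key j < ?key i"
    using top_subset_exists[of "{0..k}" ?key "\<alpha> 0"] by auto
  have "?c j \<le> ?c i" if "i \<in> S" "j \<in> {0..k} - S" for i j
    using key[of j i] S(1,3) that by auto
  then obtain R' where R': "R' 0 = S" "margins k (Suc n) R' \<alpha> ?c"
    using margins_first_row[OF Suc.prems(2) S(1,2)] by blast
  \<comment> \<open>A column of \<open>S\<close> has a one in the first row, so its sum is positive.
    The position \<open>z\<close> of a zero entry therefore stays outside \<open>S\<close>.\<close>
  have "?c i \<noteq> 0" if "i \<in> S" for i
  proof -
    have "?c i = (\<Sum>r<Suc n. of_bool (i \<in> R' r))"
      using R'(2) subsetD[OF S(1) that] unfolding margins_def by simp
    then show ?thesis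
      using R'(1) that by (simp add: sum.lessThan_Suc_shift del: sum.lessThan_Suc)
  qed
  then have zS: "z \<notin> S"
    using z(2) by blast
  have "dominates_ahead k ?c S"
    using top_dominates_ahead[OF S(1) z(1) zS] S(3) by blast
  then obtain d v where d: "word_eq k u (d @ v)" "cyc_word k d" "set d = S"
      "weight k ?c = length d + weight k (code k v)"
    using strip_cyc_word[OF Suc.prems(1) S(1) z(1) zS] by blast
  have cu: "?c = act k d (code k v)"
    using code_word_eq[OF k_pos d(1)] by (simp add: code_append)
  have sv: "set v \<subseteq> {0..k}" "set d \<subseteq> {0..k}"
    using word_eq_set[OF k_pos d(1)] by auto
  obtain \<pi> where \<pi>: "bij_betw \<pi> {0..k} {0..k}"
      "\<And>j. j \<le> k \<Longrightarrow> ?c j = code k v (\<pi> j) + of_bool (j \<in> S)"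
    using act_cyc_word[OF d(2), of "code k v"] d(3,4) cu by auto
  have "margins k n (\<lambda>r. R' (Suc r)) (\<lambda>r. \<alpha> (Suc r)) (\<lambda>j. code k v (\<pi> j))"
    by (rule margins_cong[OF margins_tail[OF R'(2)]]) (simp_all add: \<pi>(2) R'(1))
  \<comment> \<open>The inverse permutation turns the reduced column sums into the code of
    \<open>v\<close> itself.\<close>
  then obtain Q where "margins k n Q (\<lambda>r. \<alpha> (Suc r)) (\<lambda>j. code k v (\<pi> (inv_into {0..k} \<pi> j)))"
    using margins_permute[OF _ bij_betw_inv_into[OF \<pi>(1)]] by blast
  then have "margins k n Q (\<lambda>r. \<alpha> (Suc r)) (code k v)"
    by (rule margins_cong) (simp_all add: bij_betw_inv_into_right[OF \<pi>(1)])
  then obtain ds where ds: "length ds = n"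
      "\<forall>r<n. cyc_word k (ds ! r) \<and> length (ds ! r) = \<alpha> (Suc r)"
      "word_eq k v (concat ds)" "length (concat ds) = weight k (code k v)"
    using Suc.IH[OF sv(1)] by blast
  have "length d = \<alpha> 0"
    using d(2,3) S(2) distinct_card[of d] by (simp add: cyc_word_def)
  then have "\<forall>r<Suc n. cyc_word k ((d # ds) ! r) \<and> length ((d # ds) ! r) = \<alpha> r"
    using ds(2) d(2) by (simp add: All_less_Suc2)
  moreover have "word_eq k (d @ v) (d @ concat ds)"
    using word_eq.append[OF word_eq.refl ds(3)] sv(2) by simp
  then have "word_eq k u (concat (d # ds))"
    using word_eq.trans[OF d(1)] by simp
  ultimately show ?case
    using ds(1,4) d(4) by (intro exI[of _ "d # ds"]) simp
qed

end

section \<open>Decompositions and the support\<close>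

context
  fixes k :: nat
  assumes k_pos: "1 \<le> k"
begin

lemma mem_class_iff: "v \<in> word_rel k `` {u} \<longleftrightarrow> word_eq k u v"
  by (simp add: word_rel_def)

lemma class_eq_iff:
  "set u \<subseteq> {0..k} \<Longrightarrow> word_rel k `` {u} = word_rel k `` {v} \<longleftrightarrow> word_eq k u v"
  using equiv_class_eq[OF equiv_word_rel, of u v k] mem_class_iff word_eq.refl word_eq.sym
  by (metis case_prodI mem_Collect_eq word_rel_def)

lemma class_in_carrier: "set u \<subseteq> {0..k} \<Longrightarrow> word_rel k `` {u} \<in> carrier (affine_sym k)"
  by (auto simp: affine_sym_def in_lists_conv_set intro!: quotientI)

lemma carrier_obtain_word:
  assumes "w \<in> carrier (affine_sym k)"
  obtains u where "set u \<subseteq> {0..k}" "w = word_rel k `` {u}"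
  using assms by (auto simp: affine_sym_def in_lists_conv_set elim!: quotientE)

lemma foldr_mult_class:
  "\<forall>d\<in>set ds. set d \<subseteq> {0..k} \<Longrightarrow>
    foldr (\<otimes>\<^bsub>affine_sym k\<^esub>) (map (\<lambda>d. word_rel k `` {d}) ds) \<one>\<^bsub>affine_sym k\<^esub> =
      word_rel k `` {concat ds}"
proof (induction ds)
  case Nil
  show ?case by (simp add: affine_sym_def)
next
  case (Cons d ds)
  then have "set d \<subseteq> {0..k}" "set (concat ds) \<subseteq> {0..k}"
    unfolding set_concat by auto
  then have "d \<in> lists {0..k}" "concat ds \<in> lists {0..k}"
    by (simp_all only: lists_eq_set mem_Collect_eq)
  then show ?case
    using Cons by (simp add: affine_sym_mult_class)
qed

text \<open>No word for the element is shorter than the weight of its code, and some word attains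
  it.\<close>

lemma len_class:
  assumes "set u \<subseteq> {0..k}"
  shows "len (word_rel k `` {u}) = weight k (code k u)"
  unfolding len_def
proof (rule Least_equality)
  show "\<exists>v\<in>word_rel k `` {u}. length v = weight k (code k u)"
    using reduced_word_exists[OF k_pos assms] unfolding Bex_def mem_class_iff .
  fix l assume "\<exists>v\<in>word_rel k `` {u}. length v = l"
  then obtain v where v: "word_eq k u v" "length v = l"
    unfolding Bex_def mem_class_iff by blast
  then show "weight k (code k u) \<le> l"
    using weight_code_le[OF k_pos] word_eq_set[OF k_pos v(1)] code_word_eq[OF k_pos v(1)] by metis
qed

lemma cyclically_decreasing_iff:
  "cyclically_decreasing k v \<longleftrightarrow>
    (\<exists>d. cyc_word k d \<and> v = word_rel k `` {d} \<and> length d = len v)"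
proof
  assume v: "cyclically_decreasing k v"
  then obtain d where d: "d \<in> v" "length d = len v" "distinct d"
      "\<forall>p<length d. \<forall>q<length d. d ! p = next_idx k (d ! q) \<longrightarrow> p < q"
    unfolding cyclically_decreasing_def reduced_word_def by blast
  obtain u where u: "set u \<subseteq> {0..k}" "v = word_rel k `` {u}"
    using v carrier_obtain_word unfolding cyclically_decreasing_def by blast
  have ud: "word_eq k u d"
    using d(1) unfolding u(2) mem_class_iff .
  then have "set d \<subseteq> {0..k}" "v = word_rel k `` {d}"
    using word_eq_set[OF k_pos ud] class_eq_iff[OF u(1)] u(2) by auto
  then show "\<exists>d. cyc_word k d \<and> v = word_rel k `` {d} \<and> length d = len v"
    using d unfolding cyc_word_def by blast
next
  assume "\<exists>d. cyc_word k d \<and> v = word_rel k `` {d} \<and> length d = len v"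
  then obtain d where d: "cyc_word k d" "v = word_rel k `` {d}" "length d = len v"
    by blast
  then have "set d \<subseteq> {0..k}"
    by (simp add: cyc_word_def)
  then have "v \<in> carrier (affine_sym k)" "d \<in> v"
    unfolding d(2) mem_class_iff by (rule class_in_carrier, rule word_eq.refl)
  then have "v \<in> carrier (affine_sym k)" "reduced_word v d"
    using d(3) by (simp_all add: reduced_word_def)
  then show "cyclically_decreasing k v"
    using d(1) unfolding cyclically_decreasing_def cyc_word_def by blast
qed

text \<open>Reduced cyclically decreasing words for the factors are concatenated; additivity of
  lengths makes the result a reduced word for the whole element.\<close>

lemma margins_of_decomp:
  assumes "set u \<subseteq> {0..k}" "cyc_dec_decomp k (word_rel k `` {u}) ws"
  shows "\<exists>R. margins k (length ws) R (\<lambda>r. len (ws ! r)) (code k u)"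
proof -
  have "\<forall>v\<in>set ws. \<exists>d. cyc_word k d \<and> v = word_rel k `` {d} \<and> length d = len v"
    using assms(2) by (simp add: cyc_dec_decomp_def cyclically_decreasing_iff)
  then obtain f where f: "\<And>v. v \<in> set ws \<Longrightarrow>
      cyc_word k (f v) \<and> v = word_rel k `` {f v} \<and> length (f v) = len v"
    by metis
  let ?ds = "map f ws"
  have cyc: "\<forall>d\<in>set ?ds. cyc_word k d"
    using f by simp
  then have sets: "\<forall>d\<in>set ?ds. set d \<subseteq> {0..k}"
    unfolding cyc_word_def by blast
  have ws: "map (\<lambda>d. word_rel k `` {d}) ?ds = ws"
    by (simp add: map_idI f[THEN conjunct2, THEN conjunct1, symmetric])
  have "word_rel k `` {u} = word_rel k `` {concat ?ds}"
    using assms(2) foldr_mult_class[OF sets] unfolding ws cyc_dec_decomp_def by simp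
  then have eq: "word_eq k u (concat ?ds)"
    using class_eq_iff[OF assms(1)] by blast
  then have code: "code k (concat ?ds) = code k u"
    using code_word_eq[OF k_pos eq] by simp
  have "length (concat ?ds) = (\<Sum>v\<leftarrow>ws. len v)"
    using f by (simp add: length_concat comp_def cong: map_cong)
  also have "\<dots> = weight k (code k u)"
    using assms(2) len_class[OF assms(1)] by (simp add: cyc_dec_decomp_def)
  finally obtain R where "margins k (length ?ds) R (\<lambda>r. length (?ds ! r)) (code k u)"
    using margins_of_factorization[OF k_pos cyc] code by auto
  then have "margins k (length ws) R (\<lambda>r. len (ws ! r)) (code k u)"
    unfolding length_map by (rule margins_cong) (simp_all add: f)
  then show ?thesis
    by blast
qed

text \<open>A factor of a reduced word is reduced: replacing it by a shorter word would shorten the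
  whole.\<close>

lemma length_eq_len_of_concat_reduced:
  assumes "word_eq k u (concat ds)" "length (concat ds) = weight k (code k u)" "d \<in> set ds"
  shows "len (word_rel k `` {d}) = length d"
proof -
  obtain xs ys where ds: "ds = xs @ d # ys"
    using assms(3) by (meson split_list)
  have sets: "set (concat xs) \<subseteq> {0..k}" "set d \<subseteq> {0..k}" "set (concat ys) \<subseteq> {0..k}"
    using word_eq_set[OF k_pos assms(1)] unfolding ds by auto
  obtain e where e: "word_eq k d e" "length e = weight k (code k d)"
    using reduced_word_exists[OF k_pos sets(2)] by blast
  have "word_eq k (concat ds) (concat xs @ e @ concat ys)"
    using word_eq.append[OF word_eq.refl[OF sets(1)] word_eq_append_left[OF k_pos e(1) sets(3)]]
    by (simp add: ds)
  then have *: "word_eq k u (concat xs @ e @ concat ys)"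
    by (rule word_eq.trans[OF assms(1)])
  have "weight k (code k u) \<le> length (concat xs @ e @ concat ys)"
    using weight_code_le[OF k_pos] word_eq_set[OF k_pos *] code_word_eq[OF k_pos *] by metis
  then have "length d \<le> length e"
    using assms(2) by (simp add: ds)
  then show ?thesis
    using e(2) weight_code_le[OF k_pos sets(2)] len_class[OF sets(2)] by simp
qed

lemma decomp_of_margins:
  assumes "set u \<subseteq> {0..k}" "margins k n R \<alpha> (code k u)"
  shows "\<exists>ws. length ws = n \<and> cyc_dec_decomp k (word_rel k `` {u}) ws \<and> (\<forall>r<n. len (ws ! r) = \<alpha> r)"
proof -
  obtain ds where ds: "length ds = n" "\<And>r. r < n \<Longrightarrow> cyc_word k (ds ! r) \<and> length (ds ! r) = \<alpha> r"
      "word_eq k u (concat ds)" "length (concat ds) = weight k (code k u)"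
    using factorization_of_margins[OF k_pos assms] by blast
  have cyc: "\<forall>d\<in>set ds. cyc_word k d"
    using ds(1,2) by (metis in_set_conv_nth)
  then have sets: "\<forall>d\<in>set ds. set d \<subseteq> {0..k}"
    unfolding cyc_word_def by blast
  note red = length_eq_len_of_concat_reduced[OF ds(3,4)]
  let ?ws = "map (\<lambda>d. word_rel k `` {d}) ds"
  have "\<forall>v\<in>set ?ws. cyclically_decreasing k v"
    using cyc red by (auto simp: cyclically_decreasing_iff)
  moreover have "word_rel k `` {u} = foldr (\<otimes>\<^bsub>affine_sym k\<^esub>) ?ws \<one>\<^bsub>affine_sym k\<^esub>"
    using foldr_mult_class[OF sets] class_eq_iff[OF assms(1)] ds(3) by simp
  moreover have "len (word_rel k `` {u}) = (\<Sum>v\<leftarrow>?ws. len v)"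
    using red ds(4) len_class[OF assms(1)] by (simp add: length_concat comp_def cong: map_cong)
  ultimately have "cyc_dec_decomp k (word_rel k `` {u}) ?ws"
    unfolding cyc_dec_decomp_def by blast
  then show ?thesis
    using ds(1,2) red by (intro exI[of _ ?ws]) simp
qed

end

section \<open>Coefficients and support of the polynomial\<close>

lemma var_power: "var i ^ e = Poly_Mapping.single (Poly_Mapping.single i e) 1"
  by (induction e) (simp_all add: var_def mult_single flip: single_add)

lemma prod_single_one:
  "(\<Prod>i\<in>A. Poly_Mapping.single (f i) (1 :: 'b :: comm_semiring_1)) =
    Poly_Mapping.single (sum f A) 1"
  by (induction A rule: infinite_finite_induct) (simp_all add: mult_single)

lemma lookup_sum_single:
  fixes n :: nat and f :: "nat \<Rightarrow> nat"
  shows "Poly_Mapping.lookup (\<Sum>i\<in>{1..n}. Poly_Mapping.single i (f i)) j =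
    (if j \<in> {1..n} then f j else 0)"
  by (simp add: Poly_Mapping.lookup_sum lookup_single when_def)

text \<open>Each decomposition contributes its monomial with coefficient one, so nothing cancels: a
  coefficient is nonzero as soon as one decomposition has these exponents.\<close>

lemma lookup_affine_stanley:
  "Poly_Mapping.lookup (affine_stanley k n w) \<alpha> =
    int (card {ws. length ws = n \<and> cyc_dec_decomp k w ws \<and>
      (\<Sum>i\<in>{1..n}. Poly_Mapping.single i (len (ws ! (i - 1)))) = \<alpha>})"
proof -
  let ?D = "{ws. length ws = n \<and> cyc_dec_decomp k w ws}"
  let ?e = "\<lambda>ws. \<Sum>i\<in>{1..n}. Poly_Mapping.single i (len (ws ! (i - 1)))"
  have "affine_stanley k n w = (\<Sum>ws\<in>?D. Poly_Mapping.single (?e ws) 1)"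
    by (simp add: affine_stanley_def var_power prod_single_one)
  then have "Poly_Mapping.lookup (affine_stanley k n w) \<alpha> =
      (\<Sum>ws\<in>?D. Poly_Mapping.lookup (Poly_Mapping.single (?e ws) 1) \<alpha>)"
    by (simp only: Poly_Mapping.lookup_sum)
  also have "\<dots> = (\<Sum>ws\<in>?D. of_bool (?e ws = \<alpha>))"
    by (simp only: lookup_single when_def of_bool_def)
  also have "\<dots> = int (card (?D \<inter> {ws. ?e ws = \<alpha>}))"
    by (rule sum_of_bool_eq) (rule finite_cyc_dec_decomps)+
  also have "?D \<inter> {ws. ?e ws = \<alpha>} =
      {ws. length ws = n \<and> cyc_dec_decomp k w ws \<and> ?e ws = \<alpha>}"
    by auto
  finally show ?thesis .
qed

lemma poly_support_affine_stanley_iff: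
  "\<alpha> \<in> poly_support n (affine_stanley k n w) \<longleftrightarrow> Poly_Mapping.keys \<alpha> \<subseteq> {1..n} \<and>
    (\<exists>ws. length ws = n \<and> cyc_dec_decomp k w ws \<and>
      (\<forall>r<n. len (ws ! r) = Poly_Mapping.lookup \<alpha> (Suc r)))"
proof -
  let ?e = "\<lambda>ws. \<Sum>i\<in>{1..n}. Poly_Mapping.single i (len (ws ! (i - 1)))"
  have e: "?e ws = \<alpha> \<longleftrightarrow> (\<forall>r<n. len (ws ! r) = Poly_Mapping.lookup \<alpha> (Suc r))"
    if "Poly_Mapping.keys \<alpha> \<subseteq> {1..n}" for ws
  proof
    assume "?e ws = \<alpha>"
    then show "\<forall>r<n. len (ws ! r) = Poly_Mapping.lookup \<alpha> (Suc r)"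
      using lookup_sum_single[where f = "\<lambda>i. len (ws ! (i - 1))" and n = n] by auto
  next
    assume R: "\<forall>r<n. len (ws ! r) = Poly_Mapping.lookup \<alpha> (Suc r)"
    show "?e ws = \<alpha>"
    proof (rule poly_mapping_eqI)
      fix j
      show "Poly_Mapping.lookup (?e ws) j = Poly_Mapping.lookup \<alpha> j"
      proof (cases "j \<in> {1..n}")
        case True
        then show ?thesis
          unfolding lookup_sum_single using R[rule_format, of "j - 1"] True by (cases j) auto
      next
        case False
        then have "j \<notin> Poly_Mapping.keys \<alpha>"
          using that by blast
        then show ?thesis
          unfolding lookup_sum_single using False by (auto simp: in_keys_iff)
      qed
    qed
  qed
  have fin: "finite {ws. length ws = n \<and> cyc_dec_decomp k w ws \<and> ?e ws = \<alpha>}"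
    by (rule finite_subset[OF _ finite_cyc_dec_decomps[of n k w]]) auto
  have "Poly_Mapping.lookup (affine_stanley k n w) \<alpha> \<noteq> 0 \<longleftrightarrow>
      (\<exists>ws. length ws = n \<and> cyc_dec_decomp k w ws \<and> ?e ws = \<alpha>)"
    unfolding lookup_affine_stanley of_nat_eq_0_iff card_0_eq[OF fin] by blast
  then show ?thesis
    unfolding poly_support_def using e by blast
qed

theorem theorem4p6:
  fixes k n :: nat and w :: "nat list set"
  assumes "k \<ge> 1"
    and "w \<in> carrier (affine_sym k)"
  shows "M_convex n (affine_stanley k n w)"
proof -
  let ?J = "poly_support n (affine_stanley k n w)"
  obtain u where u: "set u \<subseteq> {0..k}" "w = word_rel k `` {u}"
    using carrier_obtain_word[OF assms(1,2)] by blast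
  \<comment> \<open>The support consists of the row sum vectors of 0/1-matrices whose column sums
    form the fixed code of \<open>u\<close>. Rows are numbered from 0, variables from 1.\<close>
  have J: "\<alpha> \<in> ?J \<longleftrightarrow> Poly_Mapping.keys \<alpha> \<subseteq> {1..n} \<and>
      (\<exists>R. margins k n R (\<lambda>r. Poly_Mapping.lookup \<alpha> (Suc r)) (code k u))" for \<alpha>
  proof -
    have "\<exists>R. margins k n R (\<lambda>r. Poly_Mapping.lookup \<alpha> (Suc r)) (code k u)"
      if ws: "length ws = n" "cyc_dec_decomp k w ws"
        "\<forall>r<n. len (ws ! r) = Poly_Mapping.lookup \<alpha> (Suc r)" for ws
    proof -
      obtain R where "margins k n R (\<lambda>r. len (ws ! r)) (code k u)"
        using margins_of_decomp[OF assms(1) u(1)] ws(1,2) u(2) by blast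
      then have "margins k n R (\<lambda>r. Poly_Mapping.lookup \<alpha> (Suc r)) (code k u)"
        by (rule margins_cong) (simp_all add: ws(3))
      then show ?thesis
        by blast
    qed
    moreover have "\<exists>ws. length ws = n \<and> cyc_dec_decomp k w ws \<and>
        (\<forall>r<n. len (ws ! r) = Poly_Mapping.lookup \<alpha> (Suc r))"
      if "margins k n R (\<lambda>r. Poly_Mapping.lookup \<alpha> (Suc r)) (code k u)" for R
      unfolding u(2) by (rule decomp_of_margins[OF assms(1) u(1) that])
    ultimately show ?thesis
      unfolding poly_support_affine_stanley_iff by blast
  qed
  show ?thesis
    unfolding M_convex_def
  proof (intro ballI impI)
    fix \<alpha> \<beta> i
    assume \<alpha>: "\<alpha> \<in> ?J" and \<beta>: "\<beta> \<in> ?J" and i: "i \<in> {1..n}"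
      and gt: "Poly_Mapping.lookup \<beta> i < Poly_Mapping.lookup \<alpha> i"
    let ?a = "\<lambda>r. Poly_Mapping.lookup \<alpha> (Suc r)" and ?b = "\<lambda>r. Poly_Mapping.lookup \<beta> (Suc r)"
    obtain i' where i': "i = Suc i'" "i' < n"
      using i by (cases i) auto
    obtain R Q where "margins k n R ?a (code k u)" "margins k n Q ?b (code k u)"
      using \<alpha> \<beta> J by blast
    then obtain j R' where j: "j < n" "?a j < ?b j"
        and R': "margins k n R' (?a(i' := ?a i' - 1, j := Suc (?a j))) (code k u)"
      using margins_exchange[of k n R ?a _ Q ?b i'] i' gt by blast
    let ?\<gamma> = "\<alpha> - Poly_Mapping.single i 1 + Poly_Mapping.single (Suc j) 1"
    \<comment> \<open>Row \<open>j\<close> is in deficit while row \<open>i'\<close> is in surplus,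
      so the two changes to \<alpha> concern different variables.\<close>
    have "j \<noteq> i'"
      using j(2) gt i' by auto
    have lookup: "Poly_Mapping.lookup ?\<gamma> l =
        (if l = Suc j then Suc (?a j) else if l = i then ?a i' - 1 else Poly_Mapping.lookup \<alpha> l)" for l
      using \<open>j \<noteq> i'\<close> i' by (simp add: lookup_add lookup_minus lookup_single when_def)
    have "margins k n R' (\<lambda>r. Poly_Mapping.lookup ?\<gamma> (Suc r)) (code k u)"
      using R' unfolding lookup by (rule margins_cong) (simp_all add: i'(1))
    moreover have "Poly_Mapping.keys ?\<gamma> \<subseteq> {1..n}"
    proof
      fix l assume "l \<in> Poly_Mapping.keys ?\<gamma>"
      then have "l = Suc j \<or> l = i \<or> l \<in> Poly_Mapping.keys \<alpha>"
        unfolding in_keys_iff lookup by (auto split: if_splits)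
      then show "l \<in> {1..n}"
        using i j(1) \<alpha> J by auto
    qed
    ultimately have "?\<gamma> \<in> ?J"
      using J by blast
    then show "\<exists>j\<in>{1..n}. Poly_Mapping.lookup \<alpha> j < Poly_Mapping.lookup \<beta> j \<and>
        \<alpha> - Poly_Mapping.single i 1 + Poly_Mapping.single j 1 \<in> ?J"
      using j by (intro bexI[of _ "Suc j"]) auto
  qed
qed

end
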